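(* Let $m\ge2$ and $\Gamma=\Gamma_{V_{8m}}$. (1) If $m$ is even: $\mathrm{Spec}(\Gamma)=\{[0]^{2m-1},[-2]^1,[1+\sqrt{8m-7}]^1,[1-\sqrt{8m-7}]^1\}$, $E(\Gamma)=2(1+\sqrt{8m-7})$; $\mathrm{L\text{-}Spec}(\Gamma)=\{[0]^1,[4]^{2m-3},[2m]^2,[2(m+1)]^2\}$, $LE(\Gamma)=\frac{16(m-1)(m-2)}{m+1}+8$; $\mathrm{Q\text{-}Spec}(\Gamma)=\{[4]^{2m-3},[2m]^2,[2(m-1)]^1,[m+3+\sqrt{(m-1)(m+7)}]^1,[m+3-\sqrt{(m-1)(m+7)}]^1\}$, and $SE(\Gamma)=8$ if $m=2$, $SE(\Gamma)=\frac{16(m-1)(m-2)}{m+1}+2(m-1)(\sqrt{1+\frac{8}{m-1}}-1)$ if $m\ne2$. (2) If $m$ is odd: $\mathrm{Spec}(\Gamma)=\{[0]^{2m-2},[-1]^1,[\tfrac{1+\sqrt{16m-7}}{2}]^1,[\tfrac{1-\sqrt{16m-7}}{2}]^1\}$, $E(\Gamma)=1+\sqrt{16m-7}$; $\mathrm{L\text{-}Spec}(\Gamma)=\{[0]^1,[2]^{2m-2},[2m+1]^2\}$, $LE(\Gamma)=\frac{(4m-2)^2+8}{2m+1}$; $\mathrm{Q\text{-}Spec}(\Gamma)=\{[2]^{2m-2},[2m-1]^1,[\tfrac{2m+3+\sqrt{(2m-1)(2m+7)}}{2}]^1,[\tfrac{2m+3-\sqrt{(2m-1)(2m+7)}}{2}]^1\}$,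 $SE(\Gamma)=\frac{3(2m-1)(2m-3)}{2m+1}+(2m-1)\sqrt{1+\frac{8}{2m-1}}$.
   Context: $V_{8m}=\langle x,y\mid x^{2m}=y^4=1,\ yx=x^{-1}y^{-1},\ y^{-1}x=x^{-1}y\rangle$. For a finite non-abelian group $G$ with center $Z(G)$, the NCCC-graph $\Gamma_G$ has vertex set $\{x^G: x\in G\setminus Z(G)\}$ ($x^G$ the conjugacy class of $x$), distinct vertices $x^G,y^G$ adjacent iff $x'y'\neq y'x'$ for all $x'\in x^G,y'\in y^G$. For a simple graph with adjacency matrix $A$, degree matrix $D$, $L=D-A$, $Q=D+A$; Spec, L-Spec, Q-Spec are eigenvalue multisets of $A,L,Q$, $[\lambda]^k$ meaning eigenvalue $\lambda$ of multiplicity $k$. $E=\sum_{\lambda\in\mathrm{Spec}}|\lambda|$; with $\Delta=2|E(\mathcal G)|/|V(\mathcal G)|$, $LE=\sum_{\beta\in\mathrm{L\text{-}Spec}}|\beta-\Delta|$, $SE=\sum_{\gamma\in\mathrm{Q\text{-}Spec}}|\gamma-\Delta|$. *)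

theory Defs
  imports "HOL-Algebra.Algebra" "Jordan_Normal_Form.Char_Poly"
begin

definition grp_center :: "('a, 'b) monoid_scheme \<Rightarrow> 'a set" where
  "grp_center G = {z \<in> carrier G. \<forall>g \<in> carrier G. z \<otimes>\<^bsub>G\<^esub> g = g \<otimes>\<^bsub>G\<^esub> z}"

definition conj_class :: "('a, 'b) monoid_scheme \<Rightarrow> 'a \<Rightarrow> 'a set" where
  "conj_class G x = {g \<otimes>\<^bsub>G\<^esub> x \<otimes>\<^bsub>G\<^esub> inv\<^bsub>G\<^esub> g | g. g \<in> carrier G}"

text \<open>The group V_{8m} given by its presentation: a group G generated by x, y,
  satisfying the defining relations and of order 8m (the order of the presented group),
  is isomorphic to V_{8m}.\<close>
definition is_V8m :: "('a, 'b) monoid_scheme \<Rightarrow> nat \<Rightarrow> 'a \<Rightarrow> 'a \<Rightarrow> bool" where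
  "is_V8m G m x y \<longleftrightarrow> group G \<and> finite (carrier G) \<and> card (carrier G) = 8 * m \<and>
     x \<in> carrier G \<and> y \<in> carrier G \<and> generate G {x, y} = carrier G \<and>
     x [^]\<^bsub>G\<^esub> (2 * m) = \<one>\<^bsub>G\<^esub> \<and> y [^]\<^bsub>G\<^esub> (4::nat) = \<one>\<^bsub>G\<^esub> \<and>
     y \<otimes>\<^bsub>G\<^esub> x = inv\<^bsub>G\<^esub> x \<otimes>\<^bsub>G\<^esub> inv\<^bsub>G\<^esub> y \<and>
     inv\<^bsub>G\<^esub> y \<otimes>\<^bsub>G\<^esub> x = inv\<^bsub>G\<^esub> x \<otimes>\<^bsub>G\<^esub> y"

definition nccc_vertices :: "('a, 'b) monoid_scheme \<Rightarrow> 'a set set" where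
  "nccc_vertices G = {conj_class G x | x. x \<in> carrier G - grp_center G}"

definition nccc_adj :: "('a, 'b) monoid_scheme \<Rightarrow> 'a set \<Rightarrow> 'a set \<Rightarrow> bool" where
  "nccc_adj G C D \<longleftrightarrow> C \<noteq> D \<and>
     (\<forall>x' \<in> C. \<forall>y' \<in> D. x' \<otimes>\<^bsub>G\<^esub> y' \<noteq> y' \<otimes>\<^bsub>G\<^esub> x')"

text \<open>An arbitrary fixed enumeration of the vertex set; spectra do not depend on it.\<close>
definition venum :: "'v set \<Rightarrow> nat \<Rightarrow> 'v" where
  "venum V = (SOME f. bij_betw f {..<card V} V)"

definition gdeg :: "'v set \<Rightarrow> ('v \<Rightarrow> 'v \<Rightarrow> bool) \<Rightarrow> 'v \<Rightarrow> nat" where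
  "gdeg V E v = card {w \<in> V. E v w}"

definition adj_matrix :: "'v set \<Rightarrow> ('v \<Rightarrow> 'v \<Rightarrow> bool) \<Rightarrow> real mat" where
  "adj_matrix V E = mat (card V) (card V)
     (\<lambda>(i, j). if E (venum V i) (venum V j) then 1 else 0)"

definition deg_matrix :: "'v set \<Rightarrow> ('v \<Rightarrow> 'v \<Rightarrow> bool) \<Rightarrow> real mat" where
  "deg_matrix V E = mat (card V) (card V)
     (\<lambda>(i, j). if i = j then real (gdeg V E (venum V i)) else 0)"

definition lap_matrix :: "'v set \<Rightarrow> ('v \<Rightarrow> 'v \<Rightarrow> bool) \<Rightarrow> real mat" where
  "lap_matrix V E = deg_matrix V E - adj_matrix V E"

definition slap_matrix :: "'v set \<Rightarrow> ('v \<Rightarrow> 'v \<Rightarrow> bool) \<Rightarrow> real mat" where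
  "slap_matrix V E = deg_matrix V E + adj_matrix V E"

definition mat_spec :: "real mat \<Rightarrow> complex multiset" where
  "mat_spec M = proots (char_poly (map_mat complex_of_real M))"

definition Spec :: "'v set \<Rightarrow> ('v \<Rightarrow> 'v \<Rightarrow> bool) \<Rightarrow> complex multiset" where
  "Spec V E = mat_spec (adj_matrix V E)"

definition L_Spec :: "'v set \<Rightarrow> ('v \<Rightarrow> 'v \<Rightarrow> bool) \<Rightarrow> complex multiset" where
  "L_Spec V E = mat_spec (lap_matrix V E)"

definition Q_Spec :: "'v set \<Rightarrow> ('v \<Rightarrow> 'v \<Rightarrow> bool) \<Rightarrow> complex multiset" where
  "Q_Spec V E = mat_spec (slap_matrix V E)"

definition num_edges :: "'v set \<Rightarrow> ('v \<Rightarrow> 'v \<Rightarrow> bool) \<Rightarrow> nat" where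
  "num_edges V E = card {{v, w} | v w. v \<in> V \<and> w \<in> V \<and> E v w}"

definition avg_deg :: "'v set \<Rightarrow> ('v \<Rightarrow> 'v \<Rightarrow> bool) \<Rightarrow> real" where
  "avg_deg V E = 2 * real (num_edges V E) / real (card V)"

definition energy :: "'v set \<Rightarrow> ('v \<Rightarrow> 'v \<Rightarrow> bool) \<Rightarrow> real" where
  "energy V E = (\<Sum>\<^sub># (image_mset cmod (Spec V E)))"

definition L_energy :: "'v set \<Rightarrow> ('v \<Rightarrow> 'v \<Rightarrow> bool) \<Rightarrow> real" where
  "L_energy V E = (\<Sum>\<^sub># (image_mset (\<lambda>b. cmod (b - complex_of_real (avg_deg V E))) (L_Spec V E)))"

definition Q_energy :: "'v set \<Rightarrow> ('v \<Rightarrow> 'v \<Rightarrow> bool) \<Rightarrow> real" where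
  "Q_energy V E = (\<Sum>\<^sub># (image_mset (\<lambda>g. cmod (g - complex_of_real (avg_deg V E))) (Q_Spec V E)))"

end

theory Submission
  imports Defs
begin

text \<open>
  Since \<open>z = y\<^sup>2\<close> is central and \<open>y x\<^sup>i y\<^sup>-\<^sup>1 = x\<^sup>-\<^sup>i z\<^sup>i\<close>, the subgroup \<open>H = \<langle>x, z\<rangle>\<close> is abelian of index 2. Its
  noncentral classes are pairs and mutually non-adjacent, and they are adjacent to every class outside
  \<open>H\<close>, because the centralizer of a noncentral element of \<open>H\<close> is \<open>H\<close>. The classes in the coset \<open>H y\<close> are
  told apart by the parity of the exponent of \<open>x\<close>, and two of them are adjacent iff these parities
  differ. Each parity contributes \<open>q = 2\<close> classes if \<open>m\<close> is even and \<open>q = 1\<close> if \<open>m\<close> is odd, so the graph is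
  complete tripartite with parts of size \<open>2m - q\<close>, \<open>q\<close>, \<open>q\<close>. For such a graph, the
  matrices \<open>A\<close>, \<open>L\<close>, \<open>Q\<close> are a diagonal matrix plus a matrix of rank at most 3, and the determinant
  identity \<open>det (1 - U C) = det (1 - C U)\<close> reduces the characteristic polynomial to a determinant of size 3.
\<close>

section \<open>Characteristic polynomials of tripartite matrices\<close>

text \<open>Multiplying the block matrix with rows \<open>1, U\<close> and \<open>C, 1\<close> by
  the unipotent block matrix with rows \<open>1, 0\<close> and \<open>-C, 1\<close> on the right
  clears the lower left block and leaves \<open>1 - U C\<close> on the diagonal; multiplying on the
  left leaves \<open>1 - C U\<close> instead. Both products have the same determinant.\<close>

lemma det_one_minus_mult_commute:
  fixes U :: "'a :: idom mat"
  assumes U: "U \<in> carrier_mat n k" and C: "C \<in> carrier_mat k n"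
  shows "det (1\<^sub>m n - U * C) = det (1\<^sub>m k - C * U)"
proof -
  let ?X = "four_block_mat (1\<^sub>m n) U C (1\<^sub>m k)"
  let ?R = "four_block_mat (1\<^sub>m n) (0\<^sub>m n k) (- C) (1\<^sub>m k)"
  let ?X1 = "four_block_mat (1\<^sub>m n - U * C) U (0\<^sub>m k n) (1\<^sub>m k)"
  let ?X2 = "four_block_mat (1\<^sub>m n) U (0\<^sub>m k n) (1\<^sub>m k - C * U)"
  have X: "?X \<in> carrier_mat (n + k) (n + k)" and R: "?R \<in> carrier_mat (n + k) (n + k)"
    using U C by auto
  have UC: "1\<^sub>m n * 1\<^sub>m n + U * (- C) = 1\<^sub>m n - U * C" "C * 1\<^sub>m n + 1\<^sub>m k * (- C) = 0\<^sub>m k n"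
    "1\<^sub>m n * 0\<^sub>m n k + U * 1\<^sub>m k = U" "C * 0\<^sub>m n k + 1\<^sub>m k * 1\<^sub>m k = 1\<^sub>m k"
    "- C * 1\<^sub>m n + 1\<^sub>m k * C = 0\<^sub>m k n" "- C * U + 1\<^sub>m k * 1\<^sub>m k = 1\<^sub>m k - C * U"
    "1\<^sub>m n * 1\<^sub>m n + 0\<^sub>m n k * C = 1\<^sub>m n" "1\<^sub>m n * U + 0\<^sub>m n k * 1\<^sub>m k = U"
    using U C by (auto intro!: eq_matI)
  have "?X * ?R = ?X1"
    using U C by (subst mult_four_block_mat[where ?n1.0 = n and ?n2.0 = k and ?nr1.0 = n and ?nr2.0 = k and ?nc1.0 = n and ?nc2.0 = k])
      (auto simp: UC)
  moreover have "?R * ?X = ?X2"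
    using U C by (subst mult_four_block_mat[where ?n1.0 = n and ?n2.0 = k and ?nr1.0 = n and ?nr2.0 = k and ?nc1.0 = n and ?nc2.0 = k])
      (auto simp: UC)
  moreover have "det (?X * ?R) = det (?R * ?X)"
    using det_mult[OF X R] det_mult[OF R X] by simp
  ultimately have "det ?X1 = det ?X2"
    by simp
  moreover have "det ?X1 = det (1\<^sub>m n - U * C)"
    using U C by (subst det_four_block_mat_lower_left_zero[where n = n and m = k]) auto
  moreover have "det ?X2 = det (1\<^sub>m k - C * U)"
    using U C by (subst det_four_block_mat_lower_left_zero[where n = n and m = k]) auto
  ultimately show ?thesis
    by simp
qed

lemma det_mat_3:
  fixes A :: "'a :: comm_ring_1 mat"
  assumes A: "A \<in> carrier_mat 3 3"
  shows "det A = A $$ (0,0) * (A $$ (1,1) * A $$ (2,2) - A $$ (1,2) * A $$ (2,1))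
    - A $$ (0,1) * (A $$ (1,0) * A $$ (2,2) - A $$ (1,2) * A $$ (2,0))
    + A $$ (0,2) * (A $$ (1,0) * A $$ (2,1) - A $$ (1,1) * A $$ (2,0))"
proof -
  have det2: "det B = B $$ (0,0) * B $$ (1,1) - B $$ (0,1) * B $$ (1,0)"
    if B: "B \<in> carrier_mat 2 2" for B :: "'a mat"
    using B mat_delete_carrier[OF B]
    by (subst laplace_expansion_row[OF B, of 0])
      (auto simp: cofactor_def numeral_2_eq_2 det_single mat_delete_def)
  have "mat_delete A 0 j \<in> carrier_mat 2 2" for j
    using mat_delete_carrier[OF A] by simp
  with A show ?thesis
    by (subst laplace_expansion_row[OF A, of 0])
      (auto simp: cofactor_def numeral_3_eq_3 det2 mat_delete_def algebra_simps numeral_2_eq_2)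
qed

lemma index_mult_mat_sum:
  assumes "A \<in> carrier_mat nr n" "B \<in> carrier_mat n nc" "i < nr" "j < nc"
  shows "(A * B) $$ (i, j) = (\<Sum>k<n. A $$ (i, k) * B $$ (k, j))"
  using assms by (auto simp: scalar_prod_def atLeast0LessThan)

text \<open>Allows a polynomial identity to be checked only at points where the denominators
  \<open>t - d k\<close> do not vanish.\<close>

lemma poly_eqI_cofinite:
  fixes P Q :: "'a :: {idom, ring_char_0} poly"
  assumes "finite S" and eq: "\<And>t. t \<notin> S \<Longrightarrow> poly P t = poly Q t"
  shows "P = Q"
proof (rule ccontr)
  assume "P \<noteq> Q"
  then have "finite {t. poly (P - Q) t = 0}"
    by (intro poly_roots_finite) simp
  moreover have "- S \<subseteq> {t. poly (P - Q) t = 0}"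
    using eq by auto
  ultimately have "finite (- S)"
    by (rule finite_subset[rotated])
  with \<open>finite S\<close> show False
    using infinite_UNIV_char_0 by (metis finite_compl)
qed

text \<open>For \<open>t\<close> different from \<open>d 0\<close> and \<open>d 1\<close>, the
  matrix \<open>t - M\<close> is an invertible diagonal matrix times \<open>1 - U C\<close>, with
  \<open>U C\<close> factoring through dimension 3, so a 3 by 3 determinant remains. The value
  \<open>e\<close> is 1 for the adjacency and signless Laplacian matrices and -1 for the Laplacian.
  The quadratic factor stays unfactored because its roots involve square roots in general.\<close>

lemma char_poly_tripartite:
  fixes d :: "nat \<Rightarrow> complex" and e :: complex and c :: "nat \<Rightarrow> nat"
  assumes c: "\<And>i. i < n \<Longrightarrow> c i < 3"
    and card0: "card {i. i < n \<and> c i = 0} = p" and card1: "card {i. i < n \<and> c i = 1} = q"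
    and card2: "card {i. i < n \<and> c i = 2} = q"
    and p: "p \<ge> 1" and q: "q \<ge> 1" and e: "e * e = 1" and d: "d 2 = d 1"
  defines "M \<equiv> mat n n (\<lambda>(i, j). if i = j then d (c i) else if c i = c j then 0 else e)"
  shows "char_poly M = [:- d 0, 1:] ^ (p - 1) * [:- d 1, 1:] ^ (2 * q - 2) * [:- (d 1 - e * of_nat q), 1:]
     * ([:- d 0, 1:] * [:- (d 1 + e * of_nat q), 1:] - [:2 * of_nat p * of_nat q:])"
proof (rule poly_eqI_cofinite[of "{d 0, d 1}"])
  fix t :: complex
  assume t: "t \<notin> {d 0, d 1}"
  then have nz: "t - d k \<noteq> 0" if "k < 3" for k
    using that d by (auto simp: less_Suc_eq numeral_3_eq_3 numeral_2_eq_2)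
  \<comment> \<open>Row \<open>i\<close> of \<open>U\<close> selects the part of vertex
    \<open>i\<close> with weight \<open>1 / (t - d (c i))\<close>, and column \<open>j\<close> of
    \<open>C\<close> carries \<open>e\<close> at the parts other than that of \<open>j\<close>.
    Hence \<open>U * C\<close> is the off-diagonal part of \<open>M\<close> with its rows divided by
    the entries of \<open>D\<close>.\<close>
  define D where "D = mat n n (\<lambda>(i, j). if i = j then t - d (c i) else 0)"
  define U where "U = mat n 3 (\<lambda>(i, k). if c i = k then 1 / (t - d k) else 0)"
  define C where "C = mat 3 n (\<lambda>(k, j). if c j = k then 0 else e)"
  have carr: "D \<in> carrier_mat n n" "U \<in> carrier_mat n 3" "C \<in> carrier_mat 3 n"
    "M \<in> carrier_mat n n" "1\<^sub>m n - U * C \<in> carrier_mat n n"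
    by (auto simp: D_def U_def C_def M_def)
  have UC: "(U * C) $$ (i, j) = (if c i = c j then 0 else e / (t - d (c i)))" if "i < n" "j < n" for i j
  proof -
    have "(U * C) $$ (i, j) = (\<Sum>k<3. U $$ (i, k) * C $$ (k, j))"
      using that carr by (intro index_mult_mat_sum)
    also have "\<dots> = (\<Sum>k<3. if k = c i then (if c i = c j then 0 else e / (t - d (c i))) else 0)"
      using that by (intro sum.cong refl) (auto simp: U_def C_def)
    finally show ?thesis
      using c[of i] that by (simp add: sum.delta)
  qed
  \<comment> \<open>Summing over all vertices of part \<open>l\<close> produces the size of that
    part, so this 3 by 3 matrix depends only on the sizes and the weights.\<close>
  have CU: "(C * U) $$ (k, l) = (if k = l then 0 else of_nat (card {i. i < n \<and> c i = l}) * (e / (t - d l)))"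
    if "k < 3" "l < 3" for k l
  proof -
    have "(C * U) $$ (k, l) = (\<Sum>i<n. C $$ (k, i) * U $$ (i, l))"
      using that carr by (intro index_mult_mat_sum)
    also have "\<dots> = (\<Sum>i<n. if c i = l then (if k = l then 0 else e / (t - d l)) else 0)"
      using that by (intro sum.cong refl) (auto simp: U_def C_def)
    also have "\<dots> = (\<Sum>i\<in>{i. i < n \<and> c i = l}. (if k = l then 0 else e / (t - d l)))"
      by (subst sum.inter_filter[symmetric]) (auto intro!: sum.cong)
    finally show ?thesis
      by simp
  qed
  have "- char_matrix M t = D * (1\<^sub>m n - U * C)"
  proof (rule eq_matI)
    fix i j assume "i < dim_row (D * (1\<^sub>m n - U * C))" "j < dim_col (D * (1\<^sub>m n - U * C))"
    then have ij: "i < n" "j < n"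
      using carr by auto
    have "(D * (1\<^sub>m n - U * C)) $$ (i, j) = (\<Sum>k<n. D $$ (i, k) * (1\<^sub>m n - U * C) $$ (k, j))"
      using ij carr by (intro index_mult_mat_sum)
    also have "\<dots> = (\<Sum>k<n. if k = i then (t - d (c i)) * (1\<^sub>m n - U * C) $$ (k, j) else 0)"
      using ij by (intro sum.cong refl) (auto simp: D_def)
    also have "\<dots> = (t - d (c i)) * ((if i = j then 1 else 0) - (U * C) $$ (i, j))"
      using ij carr by (simp add: sum.delta)
    also have "\<dots> = (- char_matrix M t) $$ (i, j)"
      using ij nz[OF c[of i]] UC[OF ij] by (auto simp: char_matrix_def M_def field_simps)
    finally show "(- char_matrix M t) $$ (i, j) = (D * (1\<^sub>m n - U * C)) $$ (i, j)" ..
  qed (use carr in \<open>auto simp: char_matrix_def\<close>)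
  then have "poly (char_poly M) t = det D * det (1\<^sub>m n - U * C)"
    using char_poly_matrix[OF carr(4)] det_mult[OF carr(1,5)] by simp
  also have "det D = (\<Prod>i<n. t - d (c i))"
    by (subst det_lower_triangular[OF _ carr(1)])
      (auto simp: D_def prod_list_diag_prod atLeast0LessThan intro!: prod.cong)
  also have "\<dots> = (\<Prod>k<3. \<Prod>i\<in>{i. i < n \<and> c i = k}. t - d (c i))"
    using c by (subst prod.group[symmetric, where T = "{..<3}" and g = c]) (auto intro!: prod.cong)
  also have "\<dots> = (t - d 0) ^ p * (t - d 1) ^ q * (t - d 1) ^ q"
    using card0 card1 card2 d by (simp add: numeral_3_eq_3 numeral_2_eq_2)
  also have "det (1\<^sub>m n - U * C) = det (1\<^sub>m 3 - C * U)"
    by (rule det_one_minus_mult_commute) (use carr in auto)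
  also have "\<dots> = (1 + e * (of_nat q / (t - d 1)))
      * (1 - e * (of_nat q / (t - d 1)) - 2 * (of_nat p / (t - d 0)) * (of_nat q / (t - d 1)))"
  proof -
    define a where "a = of_nat p / (t - d 0)"
    define b where "b = of_nat q / (t - d 1)"
    define w where "w l = (if l = 0 then a else b)" for l :: nat
    have E: "(1\<^sub>m 3 - C * U) $$ (k, l) = (if k = l then 1 else - (e * w l))" if "k < 3" "l < 3" for k l
    proof -
      have "l = 0 \<or> l = 1 \<or> l = 2"
        using that by linarith
      then have "of_nat (card {i. i < n \<and> c i = l}) * (e / (t - d l)) = e * w l"
        using card0 card1 card2 d by (elim disjE) (simp_all add: w_def a_def b_def)
      moreover have "(1\<^sub>m 3 - C * U) $$ (k, l) = 1\<^sub>m 3 $$ (k, l) - (C * U) $$ (k, l)"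
        using that carr by (intro index_minus_mat) auto
      ultimately show ?thesis
        using that CU[OF that] by simp
    qed
    have "1\<^sub>m 3 - C * U \<in> carrier_mat 3 3"
      using carr by auto
    then have "det (1\<^sub>m 3 - C * U) = 1 - (e * e) * (2 * a * b + b * b) - 2 * e * (e * e) * (a * b * b)"
      by (simp only: det_mat_3 E) (simp add: w_def algebra_simps)
    \<comment> \<open>With \<open>e * e = 1\<close> the determinant factors. The factor
      \<open>1 + e * b\<close> is the eigenvalue of the 3 by 3 matrix at the vector (0, 1, -1),
      which exists because the last two parts have the same weight.\<close>
    also have "\<dots> = 1 - (e * e) * (b * b) - 2 * a * b - 2 * e * (a * b * b)"
      unfolding e by simp
    also have "\<dots> = (1 + e * b) * (1 - e * b - 2 * a * b)"
      by (simp add: algebra_simps)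
    finally show ?thesis
      unfolding a_def b_def .
  qed
  \<comment> \<open>One factor \<open>t - d 0\<close> and two factors \<open>t - d 1\<close> are
    split off to clear the denominators of the 3 by 3 determinant; this is where \<open>p\<close>
    and \<open>q\<close> must be positive.\<close>
  also have "(t - d 0) ^ p * (t - d 1) ^ q * (t - d 1) ^ q
      = (t - d 0) ^ (p - 1) * (t - d 1) ^ (2 * q - 2) * (t - d 0) * (t - d 1) * (t - d 1)"
  proof -
    obtain p' q' where "p = Suc p'" "q = Suc q'"
      using p q by (metis not_one_le_zero not0_implies_Suc)
    then show ?thesis
      by (simp add: mult_2 power_add)
  qed
  also have "(t - d 0) ^ (p - 1) * (t - d 1) ^ (2 * q - 2) * (t - d 0) * (t - d 1) * (t - d 1)
    * ((1 + e * (of_nat q / (t - d 1)))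
      * (1 - e * (of_nat q / (t - d 1)) - 2 * (of_nat p / (t - d 0)) * (of_nat q / (t - d 1))))
    = (t - d 0) ^ (p - 1) * (t - d 1) ^ (2 * q - 2) * (t - (d 1 - e * of_nat q))
      * ((t - d 0) * (t - (d 1 + e * of_nat q)) - 2 * of_nat p * of_nat q)"
  proof -
    have "f * r * s * s * ((1 + e * (h / s)) * (1 - e * (h / s) - 2 * (g / r) * (h / s)))
        = f * (s + e * h) * (r * (s - e * h) - 2 * g * h)" if "r \<noteq> 0" "s \<noteq> 0" for f r s g h :: complex
    proof -
      have "s + e * h = s * (1 + e * (h / s))"
        using that by (simp add: field_simps)
      moreover have "r * (s - e * h) - 2 * g * h = r * s * (1 - e * (h / s) - 2 * (g / r) * (h / s))"
        using that by (simp add: field_simps)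
      ultimately show ?thesis
        by (simp only: ac_simps)
    qed
    from this[OF nz[of 0] nz[of 1]] show ?thesis
      by (simp only: diff_diff_eq diff_diff_eq2 diff_add_eq zero_less_numeral one_less_numeral_iff semiring_norm)
  qed
  also have "\<dots> = poly ([:- d 0, 1:] ^ (p - 1) * [:- d 1, 1:] ^ (2 * q - 2) * [:- (d 1 - e * of_nat q), 1:]
     * ([:- d 0, 1:] * [:- (d 1 + e * of_nat q), 1:] - [:2 * of_nat p * of_nat q:])) t"
  proof -
    have lin: "poly [:- c, 1:] t = t - c" for c
      by simp
    show ?thesis
      by (simp only: poly_mult poly_power poly_diff lin) simp
  qed
  finally show "poly (char_poly M) t = poly ([:- d 0, 1:] ^ (p - 1) * [:- d 1, 1:] ^ (2 * q - 2) * [:- (d 1 - e * of_nat q), 1:]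
     * ([:- d 0, 1:] * [:- (d 1 + e * of_nat q), 1:] - [:2 * of_nat p * of_nat q:])) t" .
qed simp

section \<open>Complete tripartite graphs\<close>

text \<open>Spectra are complex multisets by definition; once the eigenvalues are known to be real,
  \<open>cmod\<close> becomes the real absolute value.\<close>

lemma L_energy_of_real:
  "L_Spec V E = image_mset complex_of_real S \<Longrightarrow> L_energy V E = (\<Sum>b\<in>#S. \<bar>b - avg_deg V E\<bar>)"
  by (simp add: L_energy_def image_mset.compositionality comp_def flip: of_real_diff)

lemma Q_energy_of_real:
  "Q_Spec V E = image_mset complex_of_real S \<Longrightarrow> Q_energy V E = (\<Sum>b\<in>#S. \<bar>b - avg_deg V E\<bar>)"
  by (simp add: Q_energy_def image_mset.compositionality comp_def flip: of_real_diff)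

lemma energy_of_real:
  "Spec V E = image_mset complex_of_real S \<Longrightarrow> energy V E = (\<Sum>b\<in>#S. \<bar>b\<bar>)"
  by (simp add: energy_def image_mset.compositionality comp_def)

lemma bij_betw_venum:
  assumes "finite V"
  shows "bij_betw (venum V) {..<card V} V"
proof -
  have "\<exists>f. bij_betw f {..<card V} V"
    using ex_bij_betw_nat_finite[OF assms] by (simp add: atLeast0LessThan)
  then show ?thesis
    unfolding venum_def by (rule someI_ex)
qed

text \<open>The equal sizes of \<open>V1\<close> and \<open>V2\<close> give a symmetry that splits
  the cubic factor of the characteristic polynomial into a linear and a quadratic one.\<close>

locale complete_tripartite =
  fixes V0 V1 V2 :: "'v set" and E :: "'v \<Rightarrow> 'v \<Rightarrow> bool" and p q :: nat
  assumes finite_parts: "finite V0" "finite V1" "finite V2"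
    and card_parts: "card V0 = p" "card V1 = q" "card V2 = q"
    and pos: "p \<ge> 1" "q \<ge> 1"
    and disjoint: "V0 \<inter> V1 = {}" "V0 \<inter> V2 = {}" "V1 \<inter> V2 = {}"
    and adj_iff: "\<And>v w. v \<in> V0 \<union> V1 \<union> V2 \<Longrightarrow> w \<in> V0 \<union> V1 \<union> V2 \<Longrightarrow>
      E v w \<longleftrightarrow> \<not> (v \<in> V0 \<and> w \<in> V0 \<or> v \<in> V1 \<and> w \<in> V1 \<or> v \<in> V2 \<and> w \<in> V2)"
begin

abbreviation V :: "'v set" where "V \<equiv> V0 \<union> V1 \<union> V2"

text \<open>Anything outside \<open>V\<close> also gets the value 2, which is why
  \<open>part_sets\<close> restricts to members of \<open>V\<close>.\<close>

definition part :: "'v \<Rightarrow> nat" where "part v = (if v \<in> V0 then 0 else if v \<in> V1 then 1 else 2)"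

lemma finite_V: "finite V"
  using finite_parts by simp

lemma card_V: "card V = p + 2 * q"
  using finite_parts disjoint card_parts by (subst card_Un_disjoint; auto simp: card_Un_disjoint)

lemma part_sets:
  "{v \<in> V. part v = 0} = V0" "{v \<in> V. part v = 1} = V1" "{v \<in> V. part v = 2} = V2"
  using disjoint by (auto simp: part_def)

lemma adj_iff_part: "v \<in> V \<Longrightarrow> w \<in> V \<Longrightarrow> E v w \<longleftrightarrow> part v \<noteq> part w"
  using disjoint by (auto simp: adj_iff part_def)

lemma gdeg_eq:
  assumes "v \<in> V"
  shows "gdeg V E v = (if part v = 0 then 2 * q else p + q)"
proof -
  have card_Un: "card (V1 \<union> V2) = 2 * q" "card (V0 \<union> V2) = p + q" "card (V0 \<union> V1) = p + q"
    using finite_parts disjoint card_parts by (auto simp: card_Un_disjoint)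
  consider "v \<in> V0" | "v \<in> V1" | "v \<in> V2"
    using assms by blast
  then show ?thesis
  proof cases
    case 1
    then have "{w \<in> V. E v w} = V1 \<union> V2" "part v = 0"
      using disjoint by (auto simp: adj_iff part_def)
    then show ?thesis
      by (simp add: gdeg_def card_Un)
  next
    case 2
    then have "{w \<in> V. E v w} = V0 \<union> V2" "part v = 1"
      using disjoint by (auto simp: adj_iff part_def)
    then show ?thesis
      by (simp add: gdeg_def card_Un)
  next
    case 3
    then have "{w \<in> V. E v w} = V0 \<union> V1" "part v = 2"
      using disjoint by (auto simp: adj_iff part_def)
    then show ?thesis
      by (simp add: gdeg_def card_Un)
  qed
qed

text \<open>Every edge is oriented from the part of smaller index to the part of larger index. The
  reverse of such a pair is never of this kind, so unordered edges correspond bijectively to ordered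
  pairs in three disjoint products.\<close>

lemma num_edges_eq: "num_edges V E = 2 * p * q + q * q"
proof -
  let ?S = "V0 \<times> V1 \<union> V0 \<times> V2 \<union> V1 \<times> V2"
  have "{{v, w} | v w. v \<in> V \<and> w \<in> V \<and> E v w} = (\<lambda>(v, w). {v, w}) ` ?S"
  proof
    show "{{v, w} | v w. v \<in> V \<and> w \<in> V \<and> E v w} \<subseteq> (\<lambda>(v, w). {v, w}) ` ?S"
    proof
      fix D assume "D \<in> {{v, w} | v w. v \<in> V \<and> w \<in> V \<and> E v w}"
      then obtain v w where D: "D = {v, w}" and "v \<in> V" "w \<in> V" "E v w"
        by blast
      then have "(v, w) \<in> ?S \<or> (w, v) \<in> ?S"
        using adj_iff[of v w] by blast
      then show "D \<in> (\<lambda>(v, w). {v, w}) ` ?S"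
        unfolding D by (metis (no_types, lifting) case_prod_conv image_eqI insert_commute)
    qed
    show "(\<lambda>(v, w). {v, w}) ` ?S \<subseteq> {{v, w} | v w. v \<in> V \<and> w \<in> V \<and> E v w}"
    proof
      fix D assume "D \<in> (\<lambda>(v, w). {v, w}) ` ?S"
      then obtain v w where D: "D = {v, w}" and "(v, w) \<in> ?S"
        by auto
      then have "v \<in> V" "w \<in> V" "E v w"
        using adj_iff[of v w] disjoint by blast+
      then show "D \<in> {{v, w} | v w. v \<in> V \<and> w \<in> V \<and> E v w}"
        unfolding D by blast
    qed
  qed
  moreover have "inj_on (\<lambda>(v, w). {v, w}) ?S"
  proof (rule inj_onI)
    fix a b assume ab: "a \<in> ?S" "b \<in> ?S" "(\<lambda>(v, w). {v, w}) a = (\<lambda>(v, w). {v, w}) b"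
    have "(w, v) \<notin> ?S" if "(v, w) \<in> ?S" for v w
      using that disjoint by blast
    moreover obtain v w where "a = (v, w)"
      by fastforce
    moreover obtain v' w' where "b = (v', w')"
      by fastforce
    ultimately show "a = b"
      using ab by (simp only: case_prod_conv doubleton_eq_iff) metis
  qed
  moreover have "card ?S = 2 * p * q + q * q"
  proof -
    have "card ?S = card (V0 \<times> V1) + card (V0 \<times> V2) + card (V1 \<times> V2)"
    proof -
      have "V0 \<times> V1 \<inter> V0 \<times> V2 = {}" "(V0 \<times> V1 \<union> V0 \<times> V2) \<inter> V1 \<times> V2 = {}"
        using disjoint by blast+
      then show ?thesis
        using finite_parts by (simp only: card_Un_disjoint finite_cartesian_product finite_Un)
    qed
    then show ?thesis
      by (simp add: card_cartesian_product card_parts)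
  qed
  ultimately show ?thesis
    by (simp add: num_edges_def card_image)
qed

lemma avg_deg_eq: "avg_deg V E = 2 * (2 * real p * real q + real q * real q) / (real p + 2 * real q)"
  by (simp add: avg_deg_def num_edges_eq card_V)

text \<open>The roots \<open>r\<close> and \<open>s\<close> of the quadratic factor enter only
  through their sum and product, so no square roots occur here and each caller supplies its own
  closed form.\<close>

lemma mat_spec_eq:
  fixes d0 d1 e r s :: real
  assumes M: "M = mat (card V) (card V) (\<lambda>(i, j). if i = j then if part (venum V i) = 0 then d0 else d1
      else if part (venum V i) = part (venum V j) then 0 else e)"
    and e: "e * e = 1" and sum: "r + s = d0 + d1 + e * q" and prod: "r * s = d0 * (d1 + e * q) - 2 * p * q"
  shows "mat_spec M = image_mset complex_of_real
    (replicate_mset (p - 1) d0 + replicate_mset (2 * q - 2) d1 + {#d1 - e * q, r, s#})"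
proof -
  define c where "c i = part (venum V i)" for i
  define d where "d k = complex_of_real (if k = 0 then d0 else d1)" for k :: nat
  have card_c: "card {i. i < card V \<and> c i = k} = card {v \<in> V. part v = k}" for k
    using bij_betw_venum[OF finite_V]
    by (intro bij_betw_same_card[of "venum V"]) (auto simp: bij_betw_def inj_on_def c_def)
  have cards: "card {i. i < card V \<and> c i = 0} = p" "card {i. i < card V \<and> c i = 1} = q"
    "card {i. i < card V \<and> c i = 2} = q"
    by (simp_all only: card_c part_sets card_parts)
  have map_M: "map_mat complex_of_real M = mat (card V) (card V) (\<lambda>(i, j). if i = j then d (c i)
      else if c i = c j then 0 else complex_of_real e)"
    unfolding M by (rule eq_matI) (auto simp: c_def d_def)
  have "char_poly (map_mat complex_of_real M) = [:- d 0, 1:] ^ (p - 1) * [:- d 1, 1:] ^ (2 * q - 2) * [:- (d 1 - complex_of_real e * of_nat q), 1:]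
     * ([:- d 0, 1:] * [:- (d 1 + complex_of_real e * of_nat q), 1:] - [:2 * of_nat p * of_nat q:])"
    unfolding map_M using e pos
    by (intro char_poly_tripartite cards) (simp_all add: d_def c_def part_def flip: of_real_mult)
  also have "[:- d 0, 1:] * [:- (d 1 + complex_of_real e * of_nat q), 1:] - [:2 * of_nat p * of_nat q:]
      = [:- complex_of_real r, 1:] * [:- complex_of_real s, 1:]"
  proof -
    have "complex_of_real r + complex_of_real s = d 0 + d 1 + complex_of_real e * of_nat q"
      using arg_cong[OF sum, of complex_of_real] by (simp add: d_def)
    moreover have "complex_of_real r * complex_of_real s
        = d 0 * (d 1 + complex_of_real e * of_nat q) - 2 * of_nat p * of_nat q"
      using arg_cong[OF prod, of complex_of_real] by (simp add: d_def)
    ultimately show ?thesis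
      by (simp add: algebra_simps)
  qed
  finally have "mat_spec M = proots ([:- d 0, 1:] ^ (p - 1) * [:- d 1, 1:] ^ (2 * q - 2)
      * [:- (d 1 - complex_of_real e * of_nat q), 1:] * ([:- complex_of_real r, 1:] * [:- complex_of_real s, 1:]))"
    unfolding mat_spec_def by (rule arg_cong)
  also have "\<dots> = replicate_mset (p - 1) (d 0) + replicate_mset (2 * q - 2) (d 1)
      + {#d 1 - complex_of_real e * of_nat q, complex_of_real r, complex_of_real s#}"
  proof -
    have "repeat_mset k {#z#} = replicate_mset k z" for k and z :: complex
      by (rule multiset_eqI) simp
    then show ?thesis
      by (simp add: proots_mult proots_power del: mult_pCons_left mult_pCons_right)
  qed
  finally show ?thesis
    by (simp add: d_def)
qed

lemma venum_in_V: "i < card V \<Longrightarrow> venum V i \<in> V"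
  using bij_betw_venum[OF finite_V] by (auto simp: bij_betw_def)

lemma Spec_eq:
  assumes "r + s = real q" "r * s = - (2 * real p * real q)"
  shows "Spec V E = image_mset complex_of_real
    (replicate_mset (p - 1) 0 + replicate_mset (2 * q - 2) 0 + {#- real q, r, s#})"
proof -
  \<comment> \<open>Both diagonal values are 0; the redundant conditional matches the shape expected
    by \<open>mat_spec_eq\<close>.\<close>
  have "adj_matrix V E = mat (card V) (card V) (\<lambda>(i, j). if i = j then if part (venum V i) = 0 then 0 else 0
      else if part (venum V i) = part (venum V j) then 0 else 1)"
    by (rule eq_matI) (auto simp: adj_matrix_def adj_iff_part[OF venum_in_V venum_in_V])
  from mat_spec_eq[OF this] show ?thesis
    using assms by (simp add: Spec_def)
qed

text \<open>For \<open>e = -1\<close> the quadratic has constant term 0 and roots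
  \<open>p + 2 * q\<close> and 0. The linear factor contributes \<open>p + 2 * q\<close> once
  more.\<close>

lemma L_Spec_eq:
  "L_Spec V E = image_mset complex_of_real
    (replicate_mset (p - 1) (2 * real q) + replicate_mset (2 * q - 2) (real p + real q)
      + {#real p + 2 * real q, real p + 2 * real q, 0#})"
proof -
  have "lap_matrix V E = mat (card V) (card V) (\<lambda>(i, j). if i = j then if part (venum V i) = 0 then 2 * real q else real p + real q
      else if part (venum V i) = part (venum V j) then 0 else - 1)"
    by (rule eq_matI)
      (auto simp: lap_matrix_def adj_matrix_def deg_matrix_def adj_iff_part[OF venum_in_V venum_in_V] gdeg_eq[OF venum_in_V])
  from mat_spec_eq[OF this, of "real p + 2 * real q" 0] show ?thesis
    by (simp add: L_Spec_def algebra_simps)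
qed

lemma Q_Spec_eq:
  assumes "r + s = real p + 4 * real q" "r * s = 4 * real q * real q"
  shows "Q_Spec V E = image_mset complex_of_real
    (replicate_mset (p - 1) (2 * real q) + replicate_mset (2 * q - 2) (real p + real q) + {#real p, r, s#})"
proof -
  have "slap_matrix V E = mat (card V) (card V) (\<lambda>(i, j). if i = j then if part (venum V i) = 0 then 2 * real q else real p + real q
      else if part (venum V i) = part (venum V j) then 0 else 1)"
    by (rule eq_matI)
      (auto simp: slap_matrix_def adj_matrix_def deg_matrix_def adj_iff_part[OF venum_in_V venum_in_V] gdeg_eq[OF venum_in_V])
  from mat_spec_eq[OF this, of r s] show ?thesis
    using assms by (simp add: Q_Spec_def algebra_simps)
qed

end

section \<open>Energies of a complete tripartite graph\<close>

context complete_tripartite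
begin

lemma energy_eq:
  assumes "r + s = real q" "r * s = - (2 * real p * real q)"
  shows "energy V E = real q + \<bar>r\<bar> + \<bar>s\<bar>"
  by (simp add: energy_of_real[OF Spec_eq[OF assms]])

lemma L_energy_eq:
  "L_energy V E = real (p - 1) * \<bar>2 * real q - avg_deg V E\<bar> + real (2 * q - 2) * \<bar>real p + real q - avg_deg V E\<bar>
    + 2 * \<bar>real p + 2 * real q - avg_deg V E\<bar> + \<bar>avg_deg V E\<bar>"
  by (simp add: L_energy_of_real[OF L_Spec_eq])

lemma Q_energy_eq:
  assumes "r + s = real p + 4 * real q" "r * s = 4 * real q * real q"
  shows "Q_energy V E = real (p - 1) * \<bar>2 * real q - avg_deg V E\<bar> + real (2 * q - 2) * \<bar>real p + real q - avg_deg V E\<bar>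
    + \<bar>real p - avg_deg V E\<bar> + \<bar>r - avg_deg V E\<bar> + \<bar>s - avg_deg V E\<bar>"
  by (simp add: Q_energy_of_real[OF Q_Spec_eq[OF assms]])

end

section \<open>Closed formulas for the part sizes that occur\<close>

lemma sqrt_factor:
  assumes "a > (0::real)"
  shows "sqrt (a * (a + 8)) = a * sqrt (1 + 8 / a)"
proof -
  have "a * (a + 8) = a\<^sup>2 * (1 + 8 / a)"
    using assms by (simp add: field_simps power2_eq_square)
  then show ?thesis
    using assms by (simp add: real_sqrt_mult)
qed

text \<open>All values come from the general spectra with \<open>p = 2 * m - 2\<close> and
  \<open>q = 2\<close>. The energies require the position of each eigenvalue relative to the average
  degree \<open>D\<close>; only \<open>2 * (m - 1)\<close> changes sides, lying below
  \<open>D\<close> for \<open>m = 2\<close> and above it for even \<open>m\<close> from 4 on, whence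
  the exceptional case.\<close>

lemma tripartite_2_2:
  fixes m :: nat
  assumes tri: "complete_tripartite V0 V1 V2 E (2 * m - 2) 2" and m: "m \<ge> 2" "even m"
  defines "V \<equiv> V0 \<union> V1 \<union> V2"
  shows "Spec V E = replicate_mset (2*m - 1) 0 + {# -2 #}
      + {# complex_of_real (1 + sqrt (8 * real m - 7)) #} + {# complex_of_real (1 - sqrt (8 * real m - 7)) #}"
    and "energy V E = 2 * (1 + sqrt (8 * real m - 7))"
    and "L_Spec V E = {# 0 #} + replicate_mset (2*m - 3) 4
      + replicate_mset 2 (of_nat (2*m)) + replicate_mset 2 (of_nat (2*(m+1)))"
    and "L_energy V E = 16 * (real m - 1) * (real m - 2) / (real m + 1) + 8"
    and "Q_Spec V E = replicate_mset (2*m - 3) 4 + replicate_mset 2 (of_nat (2*m)) + {# of_nat (2*(m - 1)) #}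
      + {# complex_of_real (real m + 3 + sqrt ((real m - 1) * (real m + 7))) #}
      + {# complex_of_real (real m + 3 - sqrt ((real m - 1) * (real m + 7))) #}"
    and "Q_energy V E = (if m = 2 then 8
      else 16 * (real m - 1) * (real m - 2) / (real m + 1) + 2 * (real m - 1) * (sqrt (1 + 8 / (real m - 1)) - 1))"
proof -
  define p where "p = 2 * m - 2"
  interpret complete_tripartite V0 V1 V2 E p 2
    unfolding p_def by (rule tri)
  define M where "M = real m"
  define s where "s = sqrt ((M - 1) * (M + 7))"
  define t where "t = sqrt (8 * M - 7)"
  have M: "M \<ge> 2" and real_nat: "real p = 2 * M - 2" "real (p - Suc 0) = 2 * M - 3"
    "real (m - 1) = M - 1"
    using m by (simp_all add: M_def p_def of_nat_diff)
  have nat_eq: "p - 1 = 2 * m - 3" "2 * m - 1 = 2 * m - 3 + 2"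
    using m by (simp_all add: p_def)
  have t: "t * t = 8 * M - 7" "t \<ge> 1" and s: "s * s = (M - 1) * (M + 7)" "s \<ge> M - 1"
    using M by (auto simp: t_def s_def intro!: real_le_rsqrt simp: power2_eq_square)
  have rs: "1 + t + (1 - t) = real 2" "(1 + t) * (1 - t) = - (2 * real p * real 2)"
    "M + 3 + s + (M + 3 - s) = real p + 4 * real 2" "(M + 3 + s) * (M + 3 - s) = 4 * real 2 * real 2"
    using t s by (simp_all add: real_nat algebra_simps)
  \<comment> \<open>The inverse is hidden behind an atom \<open>i\<close> with
    \<open>(M + 1) * i = 1\<close>, so that the energy identities become polynomial identities
    modulo this relation.\<close>
  obtain i where i: "inverse (M + 1) = i"
    by simp
  then have inv: "(M + 1) * i = 1"
    using M by auto
  define D where "D = (8 * M - 4) / (M + 1)"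
  have avg: "avg_deg V E = D"
    using M by (simp add: V_def avg_deg_eq real_nat D_def field_simps)
  \<comment> \<open>The numerators are arranged so that their signs can be read off, for instance as
    a square plus 3.\<close>
  have "4 - D = - (4 * (M - 2) / (M + 1))" "2 * M - D = 2 * (M - 1) * (M - 2) / (M + 1)"
    "M + 3 - D = ((M - 2)\<^sup>2 + 3) / (M + 1)" "2 * M - 2 - D = 2 * ((M - 4) * M + 1) / (M + 1)"
    using M by (simp_all add: D_def field_simps power2_eq_square)
  note D = this
  have abs4: "\<bar>4 - D\<bar> = 4 * (M - 2) / (M + 1)" and abs2M: "\<bar>2 * M - D\<bar> = 2 * (M - 1) * (M - 2) / (M + 1)"
    and M3: "D \<le> M + 3" and D4: "D \<ge> 4"
  proof -
    show "\<bar>4 - D\<bar> = 4 * (M - 2) / (M + 1)" "\<bar>2 * M - D\<bar> = 2 * (M - 1) * (M - 2) / (M + 1)"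
      unfolding D using M by (simp_all add: abs_mult)
    have "M + 3 - D \<ge> 0" "4 - D \<le> 0"
      unfolding D using M by simp_all
    then show "D \<le> M + 3" "D \<ge> 4"
      by simp_all
  qed
  show "Spec V E = replicate_mset (2*m - 1) 0 + {# -2 #}
      + {# complex_of_real (1 + sqrt (8 * real m - 7)) #} + {# complex_of_real (1 - sqrt (8 * real m - 7)) #}"
    unfolding V_def Spec_eq[OF rs(1,2)] nat_eq
    by (simp add: t_def M_def numeral_2_eq_2)
  show "energy V E = 2 * (1 + sqrt (8 * real m - 7))"
    unfolding V_def energy_eq[OF rs(1,2)] using t by (simp add: t_def M_def)
  show "L_Spec V E = {# 0 #} + replicate_mset (2*m - 3) 4
      + replicate_mset 2 (of_nat (2*m)) + replicate_mset 2 (of_nat (2*(m+1)))"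
    unfolding V_def L_Spec_eq nat_eq by (simp add: real_nat M_def numeral_2_eq_2 add.commute)
  show "L_energy V E = 16 * (real m - 1) * (real m - 2) / (real m + 1) + 8"
  proof -
    have "L_energy V E = (2 * M - 3) * \<bar>4 - D\<bar> + 2 * \<bar>2 * M - D\<bar> + 2 * (2 * M + 2 - D) + D"
      using L_energy_eq M M3 D4 by (simp add: real_nat avg flip: V_def)
    also have "\<dots> = 16 * (M - 1) * (M - 2) / (M + 1) + 8"
    proof -
      \<comment> \<open>The multiplier \<open>4 * M - 4\<close> of the vanishing term
        \<open>1 - (M + 1) * i\<close> is found by comparing the terms free of
        \<open>i\<close>.\<close>
      have "(2 * M - 3) * (4 * (M - 2) * i) + 2 * (2 * (M - 1) * (M - 2) * i)
          + 2 * (2 * M + 2 - (8 * M - 4) * i) + (8 * M - 4) * i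
          = 16 * (M - 1) * (M - 2) * i + 8 + (4 * M - 4) * (1 - (M + 1) * i)"
        by (simp add: algebra_simps)
      then show ?thesis
        unfolding abs4 abs2M unfolding D_def divide_inverse i by (simp add: inv)
    qed
    finally show ?thesis
      by (simp add: M_def)
  qed
  show "Q_Spec V E = replicate_mset (2*m - 3) 4 + replicate_mset 2 (of_nat (2*m)) + {# of_nat (2*(m - 1)) #}
      + {# complex_of_real (real m + 3 + sqrt ((real m - 1) * (real m + 7))) #}
      + {# complex_of_real (real m + 3 - sqrt ((real m - 1) * (real m + 7))) #}"
    unfolding V_def Q_Spec_eq[OF rs(3,4)] nat_eq
    by (simp add: real_nat s_def M_def numeral_2_eq_2) (use m in \<open>simp add: of_nat_diff algebra_simps\<close>)
  show "Q_energy V E = (if m = 2 then 8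
      else 16 * (real m - 1) * (real m - 2) / (real m + 1) + 2 * (real m - 1) * (sqrt (1 + 8 / (real m - 1)) - 1))"
  proof -
    \<comment> \<open>Since \<open>M + 3 - s \<le> 4 \<le> D \<le> M + 3\<close>, the two irrational
      eigenvalues lie on opposite sides of \<open>D\<close>, and their deviations add up to
      \<open>2 * s\<close>.\<close>
    have E: "Q_energy V E = (2 * M - 3) * \<bar>4 - D\<bar> + 2 * \<bar>2 * M - D\<bar> + \<bar>2 * M - 2 - D\<bar> + 2 * s"
      using Q_energy_eq[OF rs(3,4)] M s(2) M3 D4 by (simp add: real_nat avg flip: V_def)
    show ?thesis
    proof (cases "m = 2")
      case True
      then have "M = 2" "s = 3" "D = 4"
        by (simp_all add: M_def s_def D_def)
      with E True show ?thesis
        by simp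
    next
      case False
      with m have "m \<ge> 4"
        by presburger
      then have M4: "M \<ge> 4"
        by (simp add: M_def)
      \<comment> \<open>The numerator \<open>(M - 4) * M + 1\<close> is positive from
        \<open>M = 4\<close> on.\<close>
      then have abs: "\<bar>2 * M - 2 - D\<bar> = 2 * ((M - 4) * M + 1) / (M + 1)"
        unfolding D by simp
      have s': "s = (M - 1) * sqrt (1 + 8 / (M - 1))"
        using sqrt_factor[of "M - 1"] M by (simp add: s_def add.commute)
      have "Q_energy V E = 16 * (M - 1) * (M - 2) / (M + 1) + 2 * (s - (M - 1))"
      proof -
        have "(2 * M - 3) * (4 * (M - 2) * i) + 2 * (2 * (M - 1) * (M - 2) * i) + 2 * ((M - 4) * M + 1) * i + 2 * s
            = 16 * (M - 1) * (M - 2) * i + 2 * (s - (M - 1)) + 2 * (M - 1) * (1 - (M + 1) * i)"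
          by (simp add: algebra_simps)
        then show ?thesis
          unfolding E abs4 abs2M abs divide_inverse i by (simp add: inv)
      qed
      also have "s - (M - 1) = (M - 1) * (sqrt (1 + 8 / (M - 1)) - 1)"
        unfolding s' by (simp add: algebra_simps)
      finally show ?thesis
        using False by (simp add: M_def)
    qed
  qed
qed

text \<open>With \<open>q = 1\<close> the eigenvalue \<open>p + q\<close> of the two Laplacians has
  multiplicity 0 and disappears. For \<open>m \<ge> 3\<close> the eigenvalue
  \<open>2 * m - 1\<close> always exceeds the average degree, so the signless energy has no
  exceptional case.\<close>

lemma tripartite_1_1:
  fixes m :: nat
  assumes tri: "complete_tripartite V0 V1 V2 E (2 * m - 1) 1" and m: "m \<ge> 3"
  defines "V \<equiv> V0 \<union> V1 \<union> V2"
  shows "Spec V E = replicate_mset (2*m - 2) 0 + {# -1 #}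
      + {# complex_of_real ((1 + sqrt (16 * real m - 7)) / 2) #} + {# complex_of_real ((1 - sqrt (16 * real m - 7)) / 2) #}"
    and "energy V E = 1 + sqrt (16 * real m - 7)"
    and "L_Spec V E = {# 0 #} + replicate_mset (2*m - 2) 2 + replicate_mset 2 (of_nat (2*m + 1))"
    and "L_energy V E = ((4 * real m - 2)^2 + 8) / (2 * real m + 1)"
    and "Q_Spec V E = replicate_mset (2*m - 2) 2 + {# of_nat (2*m - 1) #}
      + {# complex_of_real ((2 * real m + 3 + sqrt ((2 * real m - 1) * (2 * real m + 7))) / 2) #}
      + {# complex_of_real ((2 * real m + 3 - sqrt ((2 * real m - 1) * (2 * real m + 7))) / 2) #}"
    and "Q_energy V E = 3 * (2 * real m - 1) * (2 * real m - 3) / (2 * real m + 1)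
      + (2 * real m - 1) * sqrt (1 + 8 / (2 * real m - 1))"
proof -
  define p where "p = 2 * m - 1"
  interpret complete_tripartite V0 V1 V2 E p 1
    unfolding p_def by (rule tri)
  define M where "M = real m"
  define s where "s = sqrt ((2 * M - 1) * (2 * M + 7))"
  define t where "t = sqrt (16 * M - 7)"
  have M: "M \<ge> 3" and real_nat: "real p = 2 * M - 1" "real (p - Suc 0) = 2 * M - 2"
    using m by (simp_all add: M_def p_def of_nat_diff)
  have nat_eq: "p - 1 = 2 * m - 2"
    by (simp add: p_def)
  have t: "t * t = 16 * M - 7" "t \<ge> 1"
    and s: "s * s = (2 * M - 1) * (2 * M + 7)" "s \<ge> 2 * M - 1"
    using M by (auto simp: t_def s_def intro!: real_le_rsqrt simp: power2_eq_square)
  have rs: "(1 + t) / 2 + (1 - t) / 2 = real 1" "(1 + t) / 2 * ((1 - t) / 2) = - (2 * real p * real 1)"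
    "(2 * M + 3 + s) / 2 + (2 * M + 3 - s) / 2 = real p + 4 * real 1"
    "(2 * M + 3 + s) / 2 * ((2 * M + 3 - s) / 2) = 4 * real 1 * real 1"
    using t s by (simp_all add: real_nat field_simps)
  obtain i where i: "inverse (2 * M + 1) = i"
    by simp
  then have inv: "(2 * M + 1) * i = 1"
    using M by auto
  define D where "D = (8 * M - 2) / (2 * M + 1)"
  have avg: "avg_deg V E = D"
    using M by (simp add: V_def avg_deg_eq real_nat D_def field_simps)
  have D: "2 - D = - (4 * (M - 1) / (2 * M + 1))" "2 * M + 3 - 2 * D = ((2 * M - 2)\<^sup>2 + 3) / (2 * M + 1)"
    "2 * M - 1 - D = (4 * (M - 2) * M + 1) / (2 * M + 1)"
    using M by (simp_all add: D_def field_simps power2_eq_square)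
  have abs2: "\<bar>2 - D\<bar> = 4 * (M - 1) / (2 * M + 1)" and abs2M: "\<bar>2 * M - 1 - D\<bar> = (4 * (M - 2) * M + 1) / (2 * M + 1)"
    and M3: "2 * D \<le> 2 * M + 3" and D2: "D \<ge> 2"
  proof -
    show "\<bar>2 - D\<bar> = 4 * (M - 1) / (2 * M + 1)" "\<bar>2 * M - 1 - D\<bar> = (4 * (M - 2) * M + 1) / (2 * M + 1)"
      unfolding D using M by (simp_all add: abs_mult)
    have "2 * M + 3 - 2 * D \<ge> 0" "2 - D \<le> 0"
      unfolding D using M by simp_all
    then show "2 * D \<le> 2 * M + 3" "D \<ge> 2"
      by simp_all
  qed
  show "Spec V E = replicate_mset (2*m - 2) 0 + {# -1 #}
      + {# complex_of_real ((1 + sqrt (16 * real m - 7)) / 2) #} + {# complex_of_real ((1 - sqrt (16 * real m - 7)) / 2) #}"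
    unfolding V_def Spec_eq[OF rs(1,2)] nat_eq by (simp add: t_def M_def)
  show "energy V E = 1 + sqrt (16 * real m - 7)"
  proof -
    have "\<bar>(1 + t) / 2\<bar> + \<bar>(1 - t) / 2\<bar> = t"
      using t(2) by (simp add: field_simps)
    then show ?thesis
      unfolding V_def energy_eq[OF rs(1,2)] by (simp add: t_def M_def)
  qed
  show "L_Spec V E = {# 0 #} + replicate_mset (2*m - 2) 2 + replicate_mset 2 (of_nat (2*m + 1))"
    unfolding V_def L_Spec_eq nat_eq by (simp add: real_nat M_def numeral_2_eq_2 add.commute)
  show "L_energy V E = ((4 * real m - 2)^2 + 8) / (2 * real m + 1)"
  proof -
    have "L_energy V E = (2 * M - 2) * \<bar>2 - D\<bar> + 2 * (2 * M + 1 - D) + D"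
      using L_energy_eq M M3 D2 by (simp add: real_nat avg flip: V_def)
    also have "\<dots> = ((4 * M - 2)^2 + 8) / (2 * M + 1)"
    proof -
      have "(2 * M - 2) * (4 * (M - 1) * i) + 2 * (2 * M + 1 - (8 * M - 2) * i) + (8 * M - 2) * i
          = ((4 * M - 2)^2 + 8) * i + (4 * M + 2) * (1 - (2 * M + 1) * i)"
        by (simp add: algebra_simps power2_eq_square)
      then show ?thesis
        unfolding abs2 unfolding D_def divide_inverse i by (simp add: inv)
    qed
    finally show ?thesis
      by (simp add: M_def)
  qed
  show "Q_Spec V E = replicate_mset (2*m - 2) 2 + {# of_nat (2*m - 1) #}
      + {# complex_of_real ((2 * real m + 3 + sqrt ((2 * real m - 1) * (2 * real m + 7))) / 2) #}
      + {# complex_of_real ((2 * real m + 3 - sqrt ((2 * real m - 1) * (2 * real m + 7))) / 2) #}"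
    unfolding V_def Q_Spec_eq[OF rs(3,4)] nat_eq
    by (simp add: s_def M_def p_def)
  show "Q_energy V E = 3 * (2 * real m - 1) * (2 * real m - 3) / (2 * real m + 1)
      + (2 * real m - 1) * sqrt (1 + 8 / (2 * real m - 1))"
  proof -
    have s': "s = (2 * M - 1) * sqrt (1 + 8 / (2 * M - 1))"
      using sqrt_factor[of "2 * M - 1"] M by (simp add: s_def add.commute)
    \<comment> \<open>From \<open>s \<ge> 2 * M - 1\<close> the smaller root is at most 2, hence at
      most \<open>D\<close>, while \<open>D\<close> is at most
      \<open>(2 * M + 3) / 2\<close>.\<close>
    have "\<bar>(2 * M + 3 + s) / 2 - D\<bar> = (2 * M + 3 + s) / 2 - D" "\<bar>(2 * M + 3 - s) / 2 - D\<bar> = D - (2 * M + 3 - s) / 2"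
      using M s(2) M3 D2 by (simp_all add: field_simps)
    then have "Q_energy V E = (2 * M - 2) * \<bar>2 - D\<bar> + \<bar>2 * M - 1 - D\<bar> + s"
      using Q_energy_eq[OF rs(3,4)] by (simp add: real_nat avg flip: V_def) (simp add: field_simps)
    also have "\<dots> = 3 * (2 * M - 1) * (2 * M - 3) / (2 * M + 1) + s"
      unfolding abs2 abs2M divide_inverse i by (simp add: algebra_simps)
    finally show ?thesis
      by (simp add: s' M_def)
  qed
qed

section \<open>The group \<open>V\<^sub>8\<^sub>m\<close>\<close>

context group
begin

text \<open>Conjugation by \<open>g\<close> is an endomorphism, and homomorphisms preserve integer
  powers.\<close>

lemma conj_int_pow:
  assumes [simp]: "g \<in> carrier G" "u \<in> carrier G"
  shows "g \<otimes> u [^] (k::int) \<otimes> inv g = (g \<otimes> u \<otimes> inv g) [^] k"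
proof -
  have "inv g \<otimes> (g \<otimes> t) = t" if "t \<in> carrier G" for t
    using that by (simp flip: m_assoc)
  then have "(\<lambda>v. g \<otimes> v \<otimes> inv g) \<in> hom G G"
    by (auto simp: hom_def m_assoc)
  from hom_int_pow[OF this] show ?thesis
    using is_group by simp
qed

lemma commute_int_pow:
  assumes [simp]: "g \<in> carrier G" "u \<in> carrier G" and "g \<otimes> u = u \<otimes> g"
  shows "g \<otimes> u [^] (k::int) = u [^] k \<otimes> g"
proof -
  have "g \<otimes> u [^] k \<otimes> inv g = u [^] k"
    using assms(3) by (simp add: conj_int_pow) (simp add: m_assoc)
  then show ?thesis
    by (simp add: inv_solve_right')
qed

lemma int_pow_period:
  assumes [simp]: "u \<in> carrier G" and "u [^] n = \<one>" and "int n dvd i - k"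
  shows "u [^] (i::int) = u [^] k"
proof -
  obtain l where l: "i = int n * l + k"
    using assms(3) by (metis add.commute diff_add_cancel dvdE diff_eq_eq)
  have "u [^] (int n * l) = \<one>"
    using assms(2) by (simp add: int_pow_int flip: int_pow_pow)
  then show ?thesis
    by (simp add: l int_pow_mult)
qed

end

locale V8m = group G for G :: "('a, 'b) monoid_scheme" (structure) +
  fixes m :: nat and x y :: 'a
  assumes m_ge_2: "m \<ge> 2" and is_V8m: "is_V8m G m x y"
begin

section \<open>Normal forms and multiplication rules\<close>

text \<open>Normal form \<open>x\<^sup>i z\<^sup>j\<close> or \<open>x\<^sup>i z\<^sup>j y\<close> with \<open>z = y\<^sup>2\<close>; the indices are integers, read modulo \<open>2m\<close> and \<open>2\<close>.\<close>

definition A :: "int \<Rightarrow> int \<Rightarrow> 'a" where "A i j = x [^] i \<otimes> (y \<otimes> y) [^] j"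

definition B :: "int \<Rightarrow> int \<Rightarrow> 'a" where "B i j = A i j \<otimes> y"

lemma xy_closed [simp]: "x \<in> carrier G" "y \<in> carrier G"
  using is_V8m by (auto simp: is_V8m_def)

lemma A_closed [simp]: "A i j \<in> carrier G" and B_closed [simp]: "B i j \<in> carrier G"
  by (auto simp: A_def B_def)

lemma z_squared: "y \<otimes> y \<otimes> (y \<otimes> y) = \<one>"
proof -
  have "y [^] (4::nat) = \<one>"
    using is_V8m by (auto simp: is_V8m_def)
  then show ?thesis
    by (simp add: numeral_eq_Suc m_assoc)
qed

lemma inv_y: "inv y = y \<otimes> y \<otimes> y"
  using z_squared by (intro inv_equality) (auto simp: m_assoc)

text \<open>The two relations give \<open>y x y = inv x = inv y x inv y\<close>. Multiplying by
  \<open>y\<close> on both sides yields \<open>z x z = x\<close> for \<open>z = y y\<close>, and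
  \<open>z z = 1\<close> finishes.\<close>

lemma zx_commute: "y \<otimes> y \<otimes> x = x \<otimes> (y \<otimes> y)"
proof -
  have r: "y \<otimes> x = inv x \<otimes> inv y" "inv y \<otimes> x = inv x \<otimes> y"
    using is_V8m by (auto simp: is_V8m_def)
  have "y \<otimes> x \<otimes> y = inv x"
    using r(1) by (simp add: m_assoc)
  moreover have "inv y \<otimes> x \<otimes> inv y = inv x"
    using r(2) by (simp add: m_assoc)
  ultimately have "y \<otimes> (y \<otimes> x \<otimes> y) \<otimes> y = y \<otimes> (inv y \<otimes> x \<otimes> inv y) \<otimes> y"
    by simp
  then have *: "y \<otimes> y \<otimes> x \<otimes> (y \<otimes> y) = x"
    by (simp add: m_assoc inv_solve_left)
  have "y \<otimes> y \<otimes> x = y \<otimes> y \<otimes> x \<otimes> (y \<otimes> y \<otimes> (y \<otimes> y))"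
    by (simp add: z_squared)
  also have "\<dots> = (y \<otimes> y \<otimes> x \<otimes> (y \<otimes> y)) \<otimes> (y \<otimes> y)"
    by (simp add: m_assoc)
  finally show ?thesis
    by (simp add: *)
qed

lemma A_mult_A: "A i j \<otimes> A k l = A (i + k) (j + l)"
proof -
  have "x [^] k \<otimes> (y \<otimes> y) = y \<otimes> y \<otimes> x [^] k"
    using commute_int_pow[of "y \<otimes> y" x k] zx_commute by simp
  then have "(y \<otimes> y) [^] j \<otimes> x [^] k = x [^] k \<otimes> (y \<otimes> y) [^] j"
    using commute_int_pow[of "x [^] k" "y \<otimes> y" j] by simp
  then have "(y \<otimes> y) [^] j \<otimes> (x [^] k \<otimes> (y \<otimes> y) [^] l) = x [^] k \<otimes> ((y \<otimes> y) [^] j \<otimes> (y \<otimes> y) [^] l)"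
    by (simp flip: m_assoc)
  then show ?thesis
    by (simp add: A_def int_pow_mult m_assoc)
qed

lemma A_0_0: "A 0 0 = \<one>"
  by (simp add: A_def)

lemma inv_A: "inv (A i j) = A (- i) (- j)"
  by (intro inv_equality) (auto simp: A_mult_A A_0_0)

lemma A_0_1: "A 0 1 = y \<otimes> y" and A_1_0: "A 1 0 = x"
  by (simp_all add: A_def)

text \<open>This direction follows from the relations alone; the converse in \<open>A_eq_iff\<close>
  needs the order of the group.\<close>

lemma A_period:
  assumes "2 * int m dvd i - k" "2 dvd j - l"
  shows "A i j = A k l"
proof -
  have "x [^] (2 * m) = \<one>"
    using is_V8m by (auto simp: is_V8m_def)
  moreover have "(y \<otimes> y) [^] (2::nat) = \<one>"
    using z_squared by (simp add: numeral_eq_Suc)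
  ultimately have "x [^] i = x [^] k" "(y \<otimes> y) [^] j = (y \<otimes> y) [^] l"
    using assms int_pow_period[of x "2 * m" i k] int_pow_period[of "y \<otimes> y" 2 j l] by auto
  then show ?thesis
    by (simp add: A_def)
qed

text \<open>The relations give \<open>y x inv y = inv x inv z\<close>, which is
  \<open>inv x z\<close> because \<open>z\<close> is its own inverse. Taking powers, conjugation by
  \<open>y\<close> inverts \<open>x\<close> and multiplies by \<open>z\<close> once for each factor
  \<open>x\<close>.\<close>

lemma y_mult_A: "y \<otimes> A i j = B (- i) (i + j)"
proof -
  have pow: "A a b [^] k = A (a * k) (b * k)" for a b k
  proof -
    have "(x [^] a \<otimes> (y \<otimes> y) [^] b) [^] k = (x [^] a) [^] k \<otimes> ((y \<otimes> y) [^] b) [^] k"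
      using A_mult_A[of a 0 0 b] A_mult_A[of 0 b a 0]
      by (intro int_pow_mult_distrib) (auto simp: A_def)
    then show ?thesis
      by (simp add: A_def int_pow_pow)
  qed
  have "y \<otimes> x \<otimes> inv y = inv x \<otimes> inv y \<otimes> inv y"
    using is_V8m by (auto simp: is_V8m_def)
  also have "\<dots> = inv x \<otimes> inv (y \<otimes> y)"
    by (simp add: inv_mult_group m_assoc)
  also have "\<dots> = A (- 1) (- 1)"
    using inv_A[of 1 0] inv_A[of 0 1] A_mult_A[of "- 1" 0 0 "- 1"] by (simp add: A_0_1 A_1_0)
  also have "\<dots> = A (- 1) 1"
    by (rule A_period) auto
  finally have conj: "y \<otimes> x \<otimes> inv y = A (- 1) 1" .
  have "y \<otimes> A i j \<otimes> inv y = y \<otimes> x [^] i \<otimes> inv y \<otimes> A 0 j"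
  proof -
    have "A 0 j \<otimes> inv y = inv y \<otimes> A 0 j"
      using commute_int_pow[of "inv y" "y \<otimes> y" j] by (simp add: A_def inv_y m_assoc)
    then show ?thesis
      using A_mult_A[of i 0 0 j] by (simp add: m_assoc) (simp add: A_def m_assoc)
  qed
  also have "\<dots> = A (- i) (i + j)"
    by (simp add: conj_int_pow conj pow A_mult_A)
  finally show ?thesis
    by (simp add: B_def inv_solve_right')
qed

lemma A_mult_B: "A i j \<otimes> B k l = B (i + k) (j + l)"
  by (simp add: B_def A_mult_A flip: m_assoc)

lemma B_mult_A: "B i j \<otimes> A k l = B (i - k) (j + k + l)"
proof -
  have "B i j \<otimes> A k l = A i j \<otimes> (y \<otimes> A k l)"
    by (simp add: B_def m_assoc)
  then show ?thesis
    by (simp add: y_mult_A A_mult_B add.assoc)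
qed

text \<open>The summand 1 records that the two trailing factors \<open>y\<close> combine to one more
  \<open>z\<close>.\<close>

lemma B_mult_B: "B i j \<otimes> B k l = A (i - k) (j + k + l + 1)"
proof -
  have "B i j \<otimes> B k l = B i j \<otimes> A k l \<otimes> y"
    by (simp add: B_def m_assoc)
  also have "\<dots> = A (i - k) (j + k + l) \<otimes> A 0 1"
    by (simp add: B_mult_A A_0_1) (simp add: B_def m_assoc)
  finally show ?thesis
    by (simp add: A_mult_A)
qed

lemmas mult_simps = A_mult_A A_mult_B B_mult_A B_mult_B

lemma inv_B: "inv (B i j) = B i (- i - j - 1)"
  by (intro inv_equality) (auto simp: B_mult_B A_0_0)

lemma B_0_0: "B 0 0 = y"
  by (simp add: B_def A_0_0)

lemma carrier_cases:
  assumes "g \<in> carrier G"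
  obtains i j where "g = A i j" | i j where "g = B i j"
proof -
  have "g \<in> generate G {x, y}"
    using assms is_V8m by (simp add: is_V8m_def)
  then have "(\<exists>i j. g = A i j) \<or> (\<exists>i j. g = B i j)"
  proof induction
    case one
    then show ?case by (metis A_0_0)
  next
    case (incl h)
    then show ?case by (metis A_1_0 B_0_0 insertE singletonD)
  next
    case (inv h)
    then show ?case by (metis A_1_0 B_0_0 inv_A inv_B insertE singletonD)
  next
    case (eng h1 h2)
    then show ?case by (metis mult_simps)
  qed
  then show ?thesis
    using that by blast
qed

text \<open>Both normal forms are packed into one map so that a single counting argument settles
  uniqueness.\<close>

definition elt :: "(int \<times> int) \<times> bool \<Rightarrow> 'a" where
  "elt = (\<lambda>((i, j), b). if b then B i j else A i j)"

text \<open>There are \<open>2 * m * 2 * 2\<close> codes, and they hit every element of a group of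
  order \<open>8 * m\<close>. A surjection between finite sets of equal size is injective, so the
  assumed order makes the normal form unique.\<close>

lemma inj_on_elt: "inj_on elt (({0..<2 * int m} \<times> {0..<2}) \<times> UNIV)"
proof (rule eq_card_imp_inj_on)
  have "carrier G = elt ` (({0..<2 * int m} \<times> {0..<2}) \<times> UNIV)" (is "_ = elt ` ?S")
  proof
    show "carrier G \<subseteq> elt ` ?S"
    proof
      fix g assume "g \<in> carrier G"
      have A: "A i j = elt ((i mod (2 * int m), j mod 2), False)"
        and B: "B i j = elt ((i mod (2 * int m), j mod 2), True)" for i j
        using A_period[of i "i mod (2 * int m)" j "j mod 2"] by (auto simp: elt_def B_def mod_eq_dvd_iff[symmetric])
      from \<open>g \<in> carrier G\<close> show "g \<in> elt ` ?S"
        by (cases rule: carrier_cases) (use m_ge_2 in \<open>auto simp: A B\<close>)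
    qed
  qed (auto simp: elt_def)
  then show "card (elt ` ?S) = card ?S"
    using is_V8m by (simp add: is_V8m_def card_cartesian_product)
qed simp

lemma elt_eq_iff: "elt ((i, j), b) = elt ((k, l), c) \<longleftrightarrow> 2 * int m dvd i - k \<and> 2 dvd j - l \<and> b = c"
proof
  assume "elt ((i, j), b) = elt ((k, l), c)"
  moreover have "elt ((a, a'), b) = elt ((a mod (2 * int m), a' mod 2), b)" for a a' b
    using A_period[of a "a mod (2 * int m)" a' "a' mod 2"] by (auto simp: elt_def B_def mod_eq_dvd_iff[symmetric])
  ultimately have "((i mod (2 * int m), j mod 2), b) = ((k mod (2 * int m), l mod 2), c)"
    using m_ge_2 by (intro inj_onD[OF inj_on_elt]) auto
  then show "2 * int m dvd i - k \<and> 2 dvd j - l \<and> b = c"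
    by (auto simp: mod_eq_dvd_iff)
next
  assume "2 * int m dvd i - k \<and> 2 dvd j - l \<and> b = c"
  then show "elt ((i, j), b) = elt ((k, l), c)"
    using A_period[of i k j l] by (auto simp: elt_def B_def)
qed

lemma A_eq_iff: "A i j = A k l \<longleftrightarrow> 2 * int m dvd i - k \<and> 2 dvd j - l"
  and B_eq_iff: "B i j = B k l \<longleftrightarrow> 2 * int m dvd i - k \<and> 2 dvd j - l"
  and A_neq_B: "A i j \<noteq> B k l"
  using elt_eq_iff[of i j False k l False] elt_eq_iff[of i j True k l True] elt_eq_iff[of i j False k l True]
  by (auto simp: elt_def)

section \<open>The center and the conjugacy classes\<close>

definition noncentral :: "int \<Rightarrow> bool" where
  "noncentral i \<longleftrightarrow> \<not> (int m dvd i \<and> even i)"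

text \<open>The right-hand element is the conjugate of \<open>A i j\<close> by \<open>y\<close>.
  Equality means that \<open>2 * m\<close> divides \<open>2 * i\<close> and 2 divides
  \<open>i\<close>, a condition independent of \<open>j\<close>.\<close>

lemma A_eq_conj_iff: "A i j = A (- i) (i + j) \<longleftrightarrow> \<not> noncentral i"
  using dvd_mult_cancel_left[of 2 "int m" i] by (auto simp: A_eq_iff noncentral_def)

lemma centerD: "z \<in> grp_center G \<Longrightarrow> g \<in> carrier G \<Longrightarrow> z \<otimes> g = g \<otimes> z"
  by (simp add: grp_center_def)

text \<open>The elements \<open>A\<close> commute with each other, and every \<open>B k l\<close>
  conjugates \<open>A i j\<close> to the same element \<open>A (- i) (i + j)\<close>.\<close>

lemma A_central_iff: "A i j \<in> grp_center G \<longleftrightarrow> \<not> noncentral i"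
proof
  assume "A i j \<in> grp_center G"
  then have "A i j \<otimes> B 0 0 = B 0 0 \<otimes> A i j"
    by (rule centerD) simp
  then have "A i j = A (- i) (i + j)"
    by (simp add: mult_simps A_eq_iff B_eq_iff)
  then show "\<not> noncentral i"
    by (simp add: A_eq_conj_iff)
next
  assume "\<not> noncentral i"
  then have *: "A i j = A (- i) (i + j)"
    by (simp add: A_eq_conj_iff)
  have "A i j \<otimes> g = g \<otimes> A i j" if "g \<in> carrier G" for g
    using that by (cases rule: carrier_cases) (use * in \<open>auto simp: mult_simps A_eq_iff B_eq_iff algebra_simps\<close>)
  then show "A i j \<in> grp_center G"
    by (auto simp: grp_center_def)
qed

text \<open>Multiplying by \<open>x\<close> on the two sides gives exponents of \<open>z\<close>
  that differ by 1, so the products are distinct.\<close>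

lemma B_not_central: "B i j \<notin> grp_center G"
proof
  assume "B i j \<in> grp_center G"
  then have "B i j \<otimes> A 1 0 = A 1 0 \<otimes> B i j"
    by (rule centerD) simp
  then show False
    by (simp add: mult_simps B_eq_iff)
qed

lemma conj_class_A: "conj_class G (A i j) = {A i j, A (- i) (i + j)}"
proof -
  have conj: "A k l \<otimes> A i j \<otimes> inv (A k l) = A i j" "B k l \<otimes> A i j \<otimes> inv (B k l) = A (- i) (i + j)" for k l
    by (auto simp: mult_simps inv_A inv_B A_eq_iff)
  show ?thesis
  proof
    show "conj_class G (A i j) \<subseteq> {A i j, A (- i) (i + j)}"
      using conj by (force simp: conj_class_def elim: carrier_cases)
    show "{A i j, A (- i) (i + j)} \<subseteq> conj_class G (A i j)"
      using conj[of 0 0, symmetric] A_closed[of 0 0] B_closed[of 0 0] unfolding conj_class_def by blast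
  qed
qed

text \<open>Every conjugation moves the index pair by a multiple of (2, 1): conjugation by
  \<open>A k l\<close> by \<open>k\<close> steps, and by \<open>B k l\<close> by
  \<open>k - i\<close> steps.\<close>

lemma conj_class_B: "conj_class G (B i j) = {B (i + 2 * k) (j + k) | k. True}"
proof -
  have conj: "A k l \<otimes> B i j \<otimes> inv (A k l) = B (i + 2 * k) (j + k)"
    "B k l \<otimes> B i j \<otimes> inv (B k l) = B (i + 2 * (k - i)) (j + (k - i))" for k l
    by (auto simp: mult_simps inv_A inv_B B_eq_iff)
  show ?thesis
  proof
    show "conj_class G (B i j) \<subseteq> {B (i + 2 * k) (j + k) | k. True}"
    proof
      fix h assume "h \<in> conj_class G (B i j)"
      then obtain g where g: "g \<in> carrier G" "h = g \<otimes> B i j \<otimes> inv g"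
        by (auto simp: conj_class_def)
      from g(1) show "h \<in> {B (i + 2 * k) (j + k) | k. True}"
        by (cases rule: carrier_cases) (use g(2) conj in blast)+
    qed
    show "{B (i + 2 * k) (j + k) | k. True} \<subseteq> conj_class G (B i j)"
    proof safe
      fix k
      show "B (i + 2 * k) (j + k) \<in> conj_class G (B i j)"
        using conj(1)[of k 0] A_closed[of k 0] unfolding conj_class_def by (metis (mono_tags, lifting) mem_Collect_eq)
    qed
  qed
qed

section \<open>The three parts of the vertex set and their sizes\<close>

definition P :: "'a set set" where
  "P = {{A i j, A (- i) (i + j)} | i j. noncentral i}"

text \<open>Only the parity of \<open>r\<close> matters; the first exponent keeps its parity under
  conjugation and under reduction modulo \<open>2 * m\<close>.\<close>

definition Q :: "int \<Rightarrow> 'a set set" where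
  "Q r = {conj_class G (B i j) | i j. even (i - r)}"

lemma nccc_vertices_eq: "nccc_vertices G = P \<union> Q 0 \<union> Q 1"
proof
  show "nccc_vertices G \<subseteq> P \<union> Q 0 \<union> Q 1"
  proof
    fix C assume "C \<in> nccc_vertices G"
    then obtain g where g: "g \<in> carrier G" "g \<notin> grp_center G" "C = conj_class G g"
      by (auto simp: nccc_vertices_def)
    from g(1) show "C \<in> P \<union> Q 0 \<union> Q 1"
      by (cases rule: carrier_cases) (use g(2,3) in \<open>auto simp: A_central_iff conj_class_A P_def Q_def\<close>)
  qed
  show "P \<union> Q 0 \<union> Q 1 \<subseteq> nccc_vertices G"
    using A_central_iff B_not_central
    by (auto simp: P_def Q_def nccc_vertices_def simp flip: conj_class_A)
qed

text \<open>Sliding along (2, 1) brings the first index to \<open>r\<close>, and then only the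
  parity of the second index remains.\<close>

lemma Q_eq:
  "Q r = {conj_class G (B r 0), conj_class G (B r 1)}"
proof -
  have shift: "conj_class G (B (r + 2 * k) j) = conj_class G (B r (j - k))" for k j
  proof -
    have "B (r + 2 * k + 2 * k') (j + k') = B (r + 2 * (k + k')) (j - k + (k + k'))"
      "B (r + 2 * k') (j - k + k') = B (r + 2 * k + 2 * (k' - k)) (j + (k' - k))" for k'
      by (simp_all add: algebra_simps)
    then show ?thesis
      unfolding conj_class_B by blast
  qed
  have mod2: "conj_class G (B r j) = conj_class G (B r (j mod 2))" for j
    using B_eq_iff[of r j r "j mod 2"] by (simp add: mod_eq_dvd_iff[symmetric])
  show ?thesis
  proof
    show "Q r \<subseteq> {conj_class G (B r 0), conj_class G (B r 1)}"
    proof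
      fix C assume "C \<in> Q r"
      then obtain i j where C: "C = conj_class G (B i j)" and "even (i - r)"
        by (auto simp: Q_def)
      then obtain k where "i = r + 2 * k"
        by (metis add.commute diff_add_cancel dvdE)
      then have "C = conj_class G (B r ((j - k) mod 2))"
        using C shift mod2 by simp
      moreover have "(j - k) mod 2 = 0 \<or> (j - k) mod 2 = 1"
        by arith
      ultimately show "C \<in> {conj_class G (B r 0), conj_class G (B r 1)}"
        by auto
    qed
    show "{conj_class G (B r 0), conj_class G (B r 1)} \<subseteq> Q r"
      by (auto simp: Q_def)
  qed
qed

text \<open>The two candidate classes coincide iff some odd \<open>k\<close> satisfies
  \<open>2 * m dvd 2 * k\<close>, that is, iff \<open>m\<close> has an odd multiple.\<close>

lemma card_Q: "card (Q r) = (if even m then 2 else 1)"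
proof -
  have "conj_class G (B r 0) = conj_class G (B r 1) \<longleftrightarrow> odd m"
  proof
    assume "conj_class G (B r 0) = conj_class G (B r 1)"
    moreover have "B r 0 \<in> conj_class G (B r 0)"
      unfolding conj_class_B by (auto intro: exI[of _ 0])
    ultimately obtain k where "B r 0 = B (r + 2 * k) (1 + k)"
      unfolding conj_class_B by auto
    then have "2 * int m dvd 2 * k" "odd k"
      by (auto simp: B_eq_iff)
    then have "int m dvd k" "odd k"
      by auto
    then show "odd m"
      by (metis dvd_trans even_of_nat)
  next
    assume odd: "odd m"
    \<comment> \<open>Moving by \<open>m\<close> steps changes the first index by
      \<open>2 * m\<close>, which is invisible, and flips the parity of the second because
      \<open>m\<close> is odd.\<close>
    have "B (r + 2 * k) (0 + k) = B (r + 2 * (k + int m)) (1 + (k + int m))"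
      "B (r + 2 * k) (1 + k) = B (r + 2 * (k + int m)) (0 + (k + int m))" for k
      using odd by (auto simp: B_eq_iff)
    then show "conj_class G (B r 0) = conj_class G (B r 1)"
      unfolding conj_class_B by blast
  qed
  then show ?thesis
    by (auto simp: Q_eq card_insert_if)
qed

text \<open>The union of \<open>P\<close> consists of two elements for each noncentral index
  \<open>i\<close> in a period, and \<open>P\<close> partitions it into pairs. The central indices
  in a period are 0 and, for even \<open>m\<close> only, \<open>m\<close>.\<close>

lemma card_P: "card P = 2 * m - (if even m then 2 else 1)"
proof -
  let ?I = "{0..<2 * int m}"
  let ?N = "{i \<in> ?I. noncentral i}"
  have Un: "\<Union>P = (\<lambda>(i, j). A i j) ` (?N \<times> {0..<2})"
  proof
    have "A i j \<in> (\<lambda>(i, j). A i j) ` (?N \<times> {0..<2})" if "noncentral i" for i j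
    proof (rule image_eqI)
      show "A i j = (\<lambda>(i, j). A i j) (i mod (2 * int m), j mod 2)"
        by (simp add: A_eq_iff mod_eq_dvd_iff[symmetric])
      have "noncentral (i mod (2 * int m))"
        using that by (simp add: noncentral_def dvd_mod_iff)
      then show "(i mod (2 * int m), j mod 2) \<in> ?N \<times> {0..<2}"
        using m_ge_2 by auto
    qed
    moreover have "noncentral (- i)" if "noncentral i" for i
      using that by (simp add: noncentral_def)
    ultimately show "\<Union>P \<subseteq> (\<lambda>(i, j). A i j) ` (?N \<times> {0..<2})"
      unfolding P_def by blast
    show "(\<lambda>(i, j). A i j) ` (?N \<times> {0..<2}) \<subseteq> \<Union>P"
      unfolding P_def by auto
  qed
  have inj: "inj_on (\<lambda>(i, j). A i j) (?N \<times> {0..<2})"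
  proof -
    have *: "i = k \<and> j = l"
      if "i \<in> ?I" "k \<in> ?I" "j \<in> {0..<2}" "l \<in> {0..<2}" "A i j = A k l" for i j k l
    proof -
      have "i mod (2 * int m) = k mod (2 * int m)" "j mod 2 = l mod 2"
        using that(5) unfolding A_eq_iff mod_eq_dvd_iff by auto
      with that show ?thesis
        by simp
    qed
    show ?thesis
    proof (rule inj_onI)
      fix a b
      assume "a \<in> ?N \<times> {0..<2}" "b \<in> ?N \<times> {0..<2}" "(\<lambda>(i, j). A i j) a = (\<lambda>(i, j). A i j) b"
      then show "a = b"
        using *[of "fst a" "fst b" "snd a" "snd b"] by (cases a; cases b) simp
    qed
  qed
  have central: "{i \<in> ?I. \<not> noncentral i} = (if even m then {0, int m} else {0})"
  proof -
    have *: "i = 0 \<or> i = int m" if "0 \<le> i" "i < 2 * int m" "int m dvd i" for i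
    proof -
      from that(3) obtain k where k: "i = int m * k"
        by (rule dvdE)
      have "k < 2" "0 \<le> k"
        using that m_ge_2 by (auto simp: k mult.commute zero_le_mult_iff)
      then have "k = 0 \<or> k = 1"
        by auto
      then show ?thesis
        using k by auto
    qed
    have "\<not> noncentral i \<longleftrightarrow> i = 0 \<or> i = int m \<and> even m" if "i \<in> ?I" for i
    proof
      assume "\<not> noncentral i"
      then have "int m dvd i" "even i"
        by (auto simp: noncentral_def)
      with *[of i] that show "i = 0 \<or> i = int m \<and> even m"
        by (metis atLeastLessThan_iff even_of_nat)
    qed (auto simp: noncentral_def)
    then show ?thesis
      using m_ge_2 by (auto simp: noncentral_def[of 0] noncentral_def[of "int m"])
  qed
  have N: "?N = ?I - {i \<in> ?I. \<not> noncentral i}"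
    by auto
  have "card ?N = 2 * m - (if even m then 2 else 1)"
    unfolding N central by (subst card_Diff_subset) (use m_ge_2 in \<open>auto simp: nat_mult_distrib\<close>)
  then have "card (\<Union>P) = 2 * (2 * m - (if even m then 2 else 1))"
    using Un inj by (simp add: card_image card_cartesian_product)
  moreover have "2 * card P = card (\<Union>P)"
  proof (rule card_partition)
    show "finite (\<Union>P)"
      unfolding Un by (intro finite_imageI finite_cartesian_product finite_subset[of ?N ?I]) auto
    then show "finite P"
      by (rule finite_UnionD)
    show "card C = 2" if "C \<in> P" for C
      using that by (auto simp: P_def A_eq_conj_iff)
    show "C \<inter> D = {}" if CD: "C \<in> P" "D \<in> P" "C \<noteq> D" for C D
    proof (rule ccontr)
      assume "C \<inter> D \<noteq> {}"
      \<comment> \<open>A block is recovered from any of its members, so blocks with a common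
        element are equal.\<close>
      have *: "C = {A k l, A (- k) (k + l)}" if "C \<in> P" "A k l \<in> C" for C k l
      proof -
        from that(1) obtain i j where C: "C = {A i j, A (- i) (i + j)}"
          by (auto simp: P_def)
        have "A (- k) (k + l) = A (- i) (i + j)" if "A k l = A i j" for i j
        proof -
          have *: "2 * int m dvd k - i" "even (l - j)"
            using that unfolding A_eq_iff by auto
          then have "even (k - i)"
            by (metis dvd_mult_left)
          with *(2) have "even (k + l - (i + j))"
            by simp
          moreover have "2 * int m dvd - k - - i"
            using *(1) dvd_minus_iff[of "2 * int m" "k - i"] by simp
          ultimately show ?thesis
            by (simp only: A_eq_iff)
        qed
        from this[of i j] this[of "- i" "i + j"] show ?thesis
          using that(2) C by auto
      qed
      from \<open>C \<inter> D \<noteq> {}\<close> obtain g where g: "g \<in> C" "g \<in> D"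
        by auto
      then obtain k l where "g = A k l"
        using CD by (auto simp: P_def)
      with g CD * show False
        by metis
    qed
  qed
  ultimately show ?thesis
    by simp
qed

lemma mem_P:
  assumes "C \<in> P" "c \<in> C"
  obtains i j where "c = A i j" "noncentral i"
proof -
  have "noncentral (- i)" if "noncentral i" for i
    using that by (simp add: noncentral_def)
  then show ?thesis
    using assms that by (auto simp: P_def)
qed

lemma mem_Q:
  assumes "C \<in> Q r" "c \<in> C"
  obtains i j where "c = B i j" "even (i - r)"
  using assms that by (force simp: Q_def conj_class_B)

text \<open>For \<open>P\<close>, finiteness follows from its positive cardinality, as infinite sets
  have cardinality 0.\<close>

lemma finite_parts: "finite P" "finite (Q r)"
  using card_P m_ge_2 by (auto simp: Q_eq intro!: card_ge_0_finite)

lemma parts_disjoint: "P \<inter> Q r = {}" "Q 0 \<inter> Q 1 = {}"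
proof -
  have mem: "B i j \<in> conj_class G (B i j)" for i j
    unfolding conj_class_B by (auto intro: exI[of _ 0])
  show "P \<inter> Q r = {}"
    using mem A_neq_B unfolding P_def Q_def by (auto, (metis insertE singletonD)+)
  have "even (i - k)" if "B k l \<in> conj_class G (B i j)" for i j k l
  proof -
    from that obtain s where "B k l = B (i + 2 * s) (j + s)"
      unfolding conj_class_B by auto
    then have "2 * int m dvd k - (i + 2 * s)"
      unfolding B_eq_iff by simp
    then have "even (k - (i + 2 * s))"
      by (metis dvd_mult_left)
    then show ?thesis
      by simp
  qed
  then have parity: "even (i - k)" if "conj_class G (B i j) = conj_class G (B k l)" for i j k l
    using that mem by metis
  show "Q 0 \<inter> Q 1 = {}"
  proof (rule ccontr)
    assume "Q 0 \<inter> Q 1 \<noteq> {}"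
    then obtain i j k l where "conj_class G (B i j) = conj_class G (B k l)" "even (i - 0)" "even (k - 1)"
      unfolding Q_def by auto
    with parity[of i j k l] show False
      by simp
  qed
qed

section \<open>Commuting elements and adjacency of classes\<close>

lemma B_commute_iff:
  "B i j \<otimes> B k l = B k l \<otimes> B i j \<longleftrightarrow> int m dvd i - k \<and> even (i - k)"
  using dvd_mult_cancel_left[of 2 "int m" "i - k"] by (auto simp: mult_simps A_eq_iff algebra_simps)

text \<open>Non-adjacency needs one commuting pair, adjacency excludes all of them. Members of
  \<open>P\<close> lie in an abelian subgroup; an element \<open>A i j\<close> commuting with some
  \<open>B k l\<close> would be central; and elements \<open>B\<close> whose first exponents have
  different parity never commute.\<close>

lemma nccc_adj_iff:
  assumes "C \<in> nccc_vertices G" "D \<in> nccc_vertices G"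
  shows "nccc_adj G C D \<longleftrightarrow> \<not> (C \<in> P \<and> D \<in> P \<or> C \<in> Q 0 \<and> D \<in> Q 0 \<or> C \<in> Q 1 \<and> D \<in> Q 1)"
proof -
  have PP: "\<not> nccc_adj G C D" if "C \<in> P" "D \<in> P" for C D
    using that by (fastforce simp: nccc_adj_def P_def A_mult_A add.commute)
  have QQ: "\<not> nccc_adj G C D" if "C \<in> Q r" "D \<in> Q r" for C D r
  proof -
    obtain i j k l where CD: "C = conj_class G (B i j)" "D = conj_class G (B k l)" "even (i - r)" "even (k - r)"
      using \<open>C \<in> Q r\<close> \<open>D \<in> Q r\<close> by (auto simp: Q_def)
    then have "even (k - i)"
      by presburger
    then obtain s where "k = i + 2 * s"
      by (metis add.commute diff_add_cancel dvdE)
    \<comment> \<open>The representative of \<open>C\<close> is slid to the first exponent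
      \<open>k\<close> of the representative of \<open>D\<close>; elements \<open>B\<close> with
      equal first exponent commute.\<close>
    then have "B k (j + s) \<in> C" "B k l \<in> D"
      by (auto simp: CD conj_class_B intro: exI[of _ s] exI[of _ 0])
    then show ?thesis
      using B_commute_iff[of k "j + s" k l] by (auto simp: nccc_adj_def)
  qed
  have PQ: "nccc_adj G C D" "nccc_adj G D C" if "C \<in> P" "D \<in> Q r" for C D r
  proof -
    have "c \<otimes> d \<noteq> d \<otimes> c" if "c \<in> C" "d \<in> D" for c d
    proof -
      obtain i j k l where "c = A i j" "noncentral i" "d = B k l"
        using mem_P[OF \<open>C \<in> P\<close> \<open>c \<in> C\<close>] mem_Q[OF \<open>D \<in> Q r\<close> \<open>d \<in> D\<close>] by metis
      then show ?thesis
        using A_eq_conj_iff[of i j] by (auto simp: mult_simps A_eq_iff B_eq_iff algebra_simps)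
    qed
    then show "nccc_adj G C D" "nccc_adj G D C"
      using parts_disjoint(1) that unfolding nccc_adj_def by fastforce+
  qed
  have Q01: "nccc_adj G C D" "nccc_adj G D C" if "C \<in> Q 0" "D \<in> Q 1" for C D
  proof -
    have "c \<otimes> d \<noteq> d \<otimes> c" if "c \<in> C" "d \<in> D" for c d
    proof -
      obtain i j where "c = B i j" "even (i - 0)"
        using \<open>C \<in> Q 0\<close> \<open>c \<in> C\<close> by (rule mem_Q)
      moreover obtain k l where "d = B k l" "even (k - 1)"
        using \<open>D \<in> Q 1\<close> \<open>d \<in> D\<close> by (rule mem_Q)
      moreover from calculation have "odd (i - k)"
        by simp
      ultimately show ?thesis
        using B_commute_iff by blast
    qed
    then show "nccc_adj G C D" "nccc_adj G D C"
      using parts_disjoint(2) that unfolding nccc_adj_def by fastforce+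
  qed
  have disj: "C \<in> P \<Longrightarrow> C \<notin> Q r" "C \<in> Q 0 \<Longrightarrow> C \<notin> P" "C \<in> Q 1 \<Longrightarrow> C \<notin> P"
    "C \<in> Q 0 \<Longrightarrow> C \<notin> Q 1" "C \<in> Q 1 \<Longrightarrow> C \<notin> Q 0" for C r
    using parts_disjoint by auto
  show ?thesis
    using assms unfolding nccc_vertices_eq
    by (elim UnE) (metis PP QQ PQ Q01 disj)+
qed

end

lemma (in V8m) complete_tripartite:
  "complete_tripartite P (Q 0) (Q 1) (nccc_adj G) (2 * m - (if even m then 2 else 1)) (if even m then 2 else 1)"
proof
  show "1 \<le> 2 * m - (if even m then 2 else 1)"
    using m_ge_2 by (cases "even m") simp_all
  show "nccc_adj G C D \<longleftrightarrow> \<not> (C \<in> P \<and> D \<in> P \<or> C \<in> Q 0 \<and> D \<in> Q 0 \<or> C \<in> Q 1 \<and> D \<in> Q 1)"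
    if "C \<in> P \<union> Q 0 \<union> Q 1" "D \<in> P \<union> Q 0 \<union> Q 1" for C D
    using that by (intro nccc_adj_iff) (simp_all only: nccc_vertices_eq)
qed (simp_all add: finite_parts card_P card_Q parts_disjoint)

theorem theorem2p11:
  fixes G :: "('a, 'b) monoid_scheme" and m :: nat and x y :: 'a
  assumes "m \<ge> 2" and "is_V8m G m x y"
  defines "V \<equiv> nccc_vertices G" and "E \<equiv> nccc_adj G"
  shows "(even m \<longrightarrow>
      Spec V E = replicate_mset (2*m - 1) 0 + {# -2 #}
                 + {# complex_of_real (1 + sqrt (8*m - 7)) #}
                 + {# complex_of_real (1 - sqrt (8*m - 7)) #}
    \<and> energy V E = 2 * (1 + sqrt (8*m - 7))
    \<and> L_Spec V E = {# 0 #} + replicate_mset (2*m - 3) 4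
                   + replicate_mset 2 (of_nat (2*m)) + replicate_mset 2 (of_nat (2*(m+1)))
    \<and> L_energy V E = 16 * (real m - 1) * (real m - 2) / (real m + 1) + 8
    \<and> Q_Spec V E = replicate_mset (2*m - 3) 4 + replicate_mset 2 (of_nat (2*m))
                   + {# of_nat (2*(m - 1)) #}
                   + {# complex_of_real (m + 3 + sqrt ((real m - 1) * (real m + 7))) #}
                   + {# complex_of_real (m + 3 - sqrt ((real m - 1) * (real m + 7))) #}
    \<and> Q_energy V E = (if m = 2 then 8
         else 16 * (real m - 1) * (real m - 2) / (real m + 1)
              + 2 * (real m - 1) * (sqrt (1 + 8 / (real m - 1)) - 1)))
  \<and> (odd m \<longrightarrow>
      Spec V E = replicate_mset (2*m - 2) 0 + {# -1 #}
                 + {# complex_of_real ((1 + sqrt (16*m - 7)) / 2) #}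
                 + {# complex_of_real ((1 - sqrt (16*m - 7)) / 2) #}
    \<and> energy V E = 1 + sqrt (16*m - 7)
    \<and> L_Spec V E = {# 0 #} + replicate_mset (2*m - 2) 2 + replicate_mset 2 (of_nat (2*m + 1))
    \<and> L_energy V E = ((4 * real m - 2)^2 + 8) / (2 * real m + 1)
    \<and> Q_Spec V E = replicate_mset (2*m - 2) 2 + {# of_nat (2*m - 1) #}
                   + {# complex_of_real ((2*m + 3 + sqrt ((2 * real m - 1) * (2 * real m + 7))) / 2) #}
                   + {# complex_of_real ((2*m + 3 - sqrt ((2 * real m - 1) * (2 * real m + 7))) / 2) #}
    \<and> Q_energy V E = 3 * (2 * real m - 1) * (2 * real m - 3) / (2 * real m + 1)
                     + (2 * real m - 1) * sqrt (1 + 8 / (2 * real m - 1)))"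
proof -
  interpret V8m G m x y
    using assms(1,2) by (auto simp: V8m_def V8m_axioms_def is_V8m_def)
  have V: "V = P \<union> Q 0 \<union> Q 1"
    by (simp add: V_def nccc_vertices_eq)
  show ?thesis
  proof (intro conjI impI)
    assume "even m"
    then have tri: "complete_tripartite P (Q 0) (Q 1) E (2 * m - 2) 2"
      using complete_tripartite by (simp add: E_def)
    note R = tripartite_2_2[OF tri assms(1) \<open>even m\<close>, folded V]
    \<comment> \<open>In the goal the subtraction under the root is taken on natural numbers before
      the coercion; it does not truncate because \<open>m \<ge> 2\<close>.\<close>
    have 8: "real (8 * m - 7) = 8 * real m - 7"
      using assms(1) by (simp add: of_nat_diff)
    show "Spec V E = replicate_mset (2*m - 1) 0 + {# -2 #}
                 + {# complex_of_real (1 + sqrt (8*m - 7)) #}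
                 + {# complex_of_real (1 - sqrt (8*m - 7)) #}"
      using R(1) unfolding 8 .
    show "energy V E = 2 * (1 + sqrt (8*m - 7))"
      using R(2) unfolding 8 .
    show "L_Spec V E = {# 0 #} + replicate_mset (2*m - 3) 4
                   + replicate_mset 2 (of_nat (2*m)) + replicate_mset 2 (of_nat (2*(m+1)))"
      by (rule R(3))
    show "L_energy V E = 16 * (real m - 1) * (real m - 2) / (real m + 1) + 8"
      by (rule R(4))
    show "Q_Spec V E = replicate_mset (2*m - 3) 4 + replicate_mset 2 (of_nat (2*m))
                   + {# of_nat (2*(m - 1)) #}
                   + {# complex_of_real (m + 3 + sqrt ((real m - 1) * (real m + 7))) #}
                   + {# complex_of_real (m + 3 - sqrt ((real m - 1) * (real m + 7))) #}"
      using R(5) by simp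
    show "Q_energy V E = (if m = 2 then 8
         else 16 * (real m - 1) * (real m - 2) / (real m + 1)
              + 2 * (real m - 1) * (sqrt (1 + 8 / (real m - 1)) - 1))"
      by (rule R(6))
  next
    assume "odd m"
    with assms(1) have "m \<ge> 3"
      by presburger
    have tri: "complete_tripartite P (Q 0) (Q 1) E (2 * m - 1) 1"
      using complete_tripartite \<open>odd m\<close> by (simp add: E_def)
    note R = tripartite_1_1[OF tri \<open>m \<ge> 3\<close>, folded V]
    have 16: "real (16 * m - 7) = 16 * real m - 7"
      using assms(1) by (simp add: of_nat_diff)
    show "Spec V E = replicate_mset (2*m - 2) 0 + {# -1 #}
                 + {# complex_of_real ((1 + sqrt (16*m - 7)) / 2) #}
                 + {# complex_of_real ((1 - sqrt (16*m - 7)) / 2) #}"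
      using R(1) unfolding 16 .
    show "energy V E = 1 + sqrt (16*m - 7)"
      using R(2) unfolding 16 .
    show "L_Spec V E = {# 0 #} + replicate_mset (2*m - 2) 2 + replicate_mset 2 (of_nat (2*m + 1))"
      by (rule R(3))
    show "L_energy V E = ((4 * real m - 2)^2 + 8) / (2 * real m + 1)"
      by (rule R(4))
    show "Q_Spec V E = replicate_mset (2*m - 2) 2 + {# of_nat (2*m - 1) #}
                   + {# complex_of_real ((2*m + 3 + sqrt ((2 * real m - 1) * (2 * real m + 7))) / 2) #}
                   + {# complex_of_real ((2*m + 3 - sqrt ((2 * real m - 1) * (2 * real m + 7))) / 2) #}"
      using R(5) by simp
    show "Q_energy V E = 3 * (2 * real m - 1) * (2 * real m - 3) / (2 * real m + 1)
                     + (2 * real m - 1) * sqrt (1 + 8 / (2 * real m - 1))"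
      by (rule R(6))
  qed
qed

end
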